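(* Let $p,n\in\mathbb{N}$, $j=\begin{bmatrix} I_p&0\\0&-I_p\end{bmatrix}$, let $c\in\mathbb{R}$ with $c\ne0$, let $\alpha$ be a $p\times p$ matrix with $\alpha\alpha^*=I_p$, and set $\beta(x)=\begin{bmatrix}\mathrm{e}^{\mathrm{i}cx}I_p&\mathrm{e}^{-\mathrm{i}cx}\alpha\end{bmatrix}$, $H(x)=\beta(x)^*\beta(x)$ for $x\ge0$. Let $\mathcal{A}$ be an invertible $n\times n$ matrix, $\mathcal{S}(0)$ a positive definite $n\times n$ matrix and $\Lambda(0)$ an $n\times 2p$ matrix such that $$\mathcal{A}\mathcal{S}(0)-\mathcal{S}(0)\mathcal{A}^*=\mathrm{i}\Lambda(0)j\Lambda(0)^*.$$ Let $\Lambda(x)$, $\mathcal{S}(x)$, $w_{\mathcal{A}}(x,\lambda)$ and $v(x,\lambda)$ be the associated functions defined in the context, and put $$\widetilde\beta(x)=\beta(x)w_{\mathcal{A}}(x,0),\qquad \widetilde H(x)=\widetilde\beta(x)^*\widetilde\beta(x)\qquad(x\ge0).$$ Then the canonical system $$\widetilde w'(x,\lambda)=\mathrm{i}\lambda j\widetilde H(x)\widetilde w(x,\lambda)\qquad\text{on }[0,\infty)$$ has a unique Weyl function (Weyl's limit point case). This Weyl function is given explicitly by $$\varphi(\lambda)=\begin{bmatrix}0&I_p\end{bmatrix}v(0,\lambda)E_1(\lambda)\Big(\begin{bmatrix}I_p&0\end{bmatrix}v(0,\lambda)E_1(\lambda)\Big)^{-1},$$ where $$E_1(\lambda)=\begin{bmatrix}-\alpha\\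 \frac1\lambda\big(\lambda+c-z_1(\lambda)\big)I_p\end{bmatrix},\qquad z_1(\lambda)^2=c(2\lambda+c),\quad \Im(z_1(\lambda))>0\qquad(\lambda\in\mathbb{C}_+).$$
   Context: $\mathbb{C}_+$ is the open upper half-plane; $^*$ is the conjugate transpose; $'$ is $d/dx$. The functions $\Lambda(x)$ ($n\times2p$) and $\mathcal{S}(x)=\mathcal{S}(x)^*$ ($n\times n$) are determined by the initial values $\Lambda(0),\mathcal{S}(0)$ and $$\Lambda'(x)=-\mathrm{i}\mathcal{A}\Lambda(x)jH(x),\qquad \mathcal{S}'(x)=\Lambda(x)jH(x)j\Lambda(x)^*.$$ Since $\mathcal{S}(0)>0$ and $H\ge0$, $\mathcal{S}(x)>0$ is invertible for all $x\ge0$. Set $$w_{\mathcal{A}}(x,\lambda)=I_{2p}-\mathrm{i}j\Lambda(x)^*\mathcal{S}(x)^{-1}(\mathcal{A}-\lambda I_n)^{-1}\Lambda(x),\qquad v(x,\lambda)=w_{\mathcal{A}}(x,0)^{-1}w_{\mathcal{A}}(x,\lambda)$$ ($w_{\mathcal{A}}(x,0)$ is invertible). Weyl function: for a canonical system $w'=\mathrm{i}\lambda jH(x)w$ on $[0,\infty)$ with Hamiltonian $H(x)\ge0$ and fundamental solution $W(x,\lambda)$ normalized by $W(0,\lambda)=I_{2p}$, a Weyl (Weyl--Titchmarsh) function is a holomorphic $p\times p$ matrix function $\varphi$ on $\mathbb{C}_+$ such that $$\int_0^\infty\begin{bmatrix}I_p&\varphi(\lambda)^*\end{bmatrix}W(x,\lambda)^*H(x)W(x,\lambda)\begin{bmatrix}I_p\\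 \varphi(\lambda)\end{bmatrix}dx<\infty\qquad(\lambda\in\mathbb{C}_+).$$ Here this notion is applied to $\widetilde H$ in place of $H$. The explicit formula for $\varphi$ is understood as an identity of meromorphic functions in $\mathbb{C}_+$: it holds for all $\lambda\in\mathbb{C}_+$ except, possibly, isolated points where the right-hand side is not defined, and there $\varphi$ is its holomorphic continuation. *)

theory Defs
  imports "HOL-Analysis.Analysis"
begin

text \<open>
  An \<open>m \<times> k\<close> complex matrix is an element of \<open>complex ^ 'k ^ 'm\<close>.  The index set of size \<open>2p\<close> is
  the sum type \<open>'p + 'p\<close>, with \<open>Inl\<close> for the first and \<open>Inr\<close> for the second block.  The spectral
  parameter is written \<open>z\<close>.
\<close>

definition cscale :: "complex \<Rightarrow> complex ^ 'k ^ 'm \<Rightarrow> complex ^ 'k ^ 'm" (infixr \<open>*c\<close> 75)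
  where "a *c M = (\<chi> i k. a * M $ i $ k)"

definition ctranspose :: "complex ^ 'k ^ 'm \<Rightarrow> complex ^ 'm ^ 'k"
  where "ctranspose M = (\<chi> i k. cnj (M $ k $ i))"

definition hstack :: "complex ^ 'k ^ 'm \<Rightarrow> complex ^ 'l ^ 'm \<Rightarrow> complex ^ ('k + 'l) ^ 'm"
  where "hstack M N = (\<chi> i s. case s of Inl k \<Rightarrow> M $ i $ k | Inr l \<Rightarrow> N $ i $ l)"

definition vstack :: "complex ^ 'k ^ 'm \<Rightarrow> complex ^ 'k ^ 'l \<Rightarrow> complex ^ 'k ^ ('m + 'l)"
  where "vstack M N = (\<chi> s. case s of Inl i \<Rightarrow> M $ i | Inr l \<Rightarrow> N $ l)"

definition jmat :: "complex ^ ('p + 'p) ^ ('p::finite + 'p)"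
  where "jmat = vstack (hstack (mat 1) 0) (hstack 0 (- mat 1))"

definition pos_def :: "complex ^ 'n ^ 'n \<Rightarrow> bool"
  where "pos_def M \<longleftrightarrow> ctranspose M = M \<and>
    (\<forall>u. u \<noteq> 0 \<longrightarrow> 0 < Re (\<Sum>i\<in>UNIV. cnj (u $ i) * (M *v u) $ i))"

definition upper_half_plane :: "complex set" (\<open>\<complex>\<^sub>+\<close>)
  where "\<complex>\<^sub>+ = {z. 0 < Im z}"

text \<open>
  Derivatives are classical, one-sided at \<open>0\<close>; this is the appropriate notion of solution for
  continuous Hamiltonians, for which the solution exists and is unique on \<open>[0, \<infinity>)\<close>.
\<close>

definition fundamental_solution ::
  "(real \<Rightarrow> complex ^ ('p + 'p) ^ ('p::finite + 'p)) \<Rightarrow> complex \<Rightarrow>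
   (real \<Rightarrow> complex ^ ('p + 'p) ^ ('p + 'p)) \<Rightarrow> bool"
  where "fundamental_solution H z W \<longleftrightarrow> W 0 = mat 1 \<and>
    (\<forall>x\<ge>0. (W has_vector_derivative (\<i> * z) *c (jmat ** H x ** W x)) (at x within {0..}))"

text \<open>
  For \<open>H \<ge> 0\<close> the matrix integrand below is positive semidefinite, so finiteness of the integral
  over \<open>[0, \<infinity>)\<close> is (entrywise) absolute integrability.
\<close>

definition weyl_function ::
  "(real \<Rightarrow> complex ^ ('p + 'p) ^ ('p::finite + 'p)) \<Rightarrow> (complex \<Rightarrow> complex ^ 'p ^ 'p) \<Rightarrow> bool"
  where "weyl_function H \<phi> \<longleftrightarrow>
    (\<forall>i k. (\<lambda>z. \<phi> z $ i $ k) holomorphic_on \<complex>\<^sub>+) \<and>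
    (\<forall>z\<in>\<complex>\<^sub>+. \<exists>W. fundamental_solution H z W \<and>
      (\<lambda>x. hstack (mat 1) (ctranspose (\<phi> z)) ** ctranspose (W x) ** H x ** W x
             ** vstack (mat 1) (\<phi> z)) absolutely_integrable_on {0..})"

definition beta :: "real \<Rightarrow> complex ^ 'p ^ 'p \<Rightarrow> real \<Rightarrow> complex ^ ('p + 'p) ^ 'p"
  where "beta c \<alpha> x =
    hstack (exp (\<i> * of_real (c * x)) *c mat 1) (exp (- \<i> * of_real (c * x)) *c \<alpha>)"

definition hamiltonian :: "(real \<Rightarrow> complex ^ ('p + 'p) ^ 'p) \<Rightarrow> real \<Rightarrow> complex ^ ('p + 'p) ^ ('p + 'p)"
  where "hamiltonian b x = ctranspose (b x) ** b x"

text \<open>The value of \<open>w\<^sub>A\<close> is meaningful only if \<open>S x\<close> and \<open>A - z I\<close> are invertible.\<close>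

definition w\<^sub>A ::
  "complex ^ 'n ^ 'n \<Rightarrow> (real \<Rightarrow> complex ^ ('p + 'p) ^ 'n) \<Rightarrow> (real \<Rightarrow> complex ^ 'n ^ 'n) \<Rightarrow>
   real \<Rightarrow> complex \<Rightarrow> complex ^ ('p + 'p) ^ ('p::finite + 'p)"
  where "w\<^sub>A A \<Lambda> S x z = mat 1 -
    \<i> *c (jmat ** ctranspose (\<Lambda> x) ** matrix_inv (S x) ** matrix_inv (A - mat z) ** \<Lambda> x)"

definition v\<^sub>A ::
  "complex ^ 'n ^ 'n \<Rightarrow> (real \<Rightarrow> complex ^ ('p + 'p) ^ 'n) \<Rightarrow> (real \<Rightarrow> complex ^ 'n ^ 'n) \<Rightarrow>
   real \<Rightarrow> complex \<Rightarrow> complex ^ ('p + 'p) ^ ('p::finite + 'p)"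
  where "v\<^sub>A A \<Lambda> S x z = matrix_inv (w\<^sub>A A \<Lambda> S x 0) ** w\<^sub>A A \<Lambda> S x z"

definition E\<^sub>1 ::
  "real \<Rightarrow> complex ^ 'p ^ 'p \<Rightarrow> (complex \<Rightarrow> complex) \<Rightarrow> complex \<Rightarrow> complex ^ 'p ^ ('p + 'p)"
  where "E\<^sub>1 c \<alpha> z\<^sub>1 z = vstack (- \<alpha>) ((1 / z * (z + of_real c - z\<^sub>1 z)) *c mat 1)"

end

theory Submission
  imports Defs "HOL-Complex_Analysis.Complex_Analysis"
begin

text \<open>
  Write \<open>J(Y) = tr (Y\<^sup>* j Y)\<close> (this is \<open>jform Y\<close>) for a \<open>2p \<times> k\<close> matrix \<open>Y\<close>.  Along a solution of a
  canonical system with Hamiltonian \<open>b\<^sup>* b\<close> one has \<open>J(Y)' = - 2 Im z |b Y|\<^sup>2\<close> (\<open>jform_derivative\<close>).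
  For \<open>Im z > 0\<close> a solution with \<open>J \<ge> 0\<close> everywhere is therefore square integrable with respect to the
  Hamiltonian, and \<open>J \<ge> 0\<close> at \<open>x = 0\<close> for the initial value \<open>[I; \<phi>]\<close> says \<open>|\<phi>|\<^sup>2 \<le> p\<close>.

  The initial system has constant coefficients after a rotation, and \<open>z\<^sub>1\<close> and \<open>- z\<^sub>1\<close> are the exponents
  of its exponential solutions (\<open>mode_solution\<close>).  The decaying one starts at \<open>E\<^sub>1\<close> and satisfies
  \<open>J > 0\<close> (\<open>ratio_less_1\<close>).  Multiplication by \<open>v\<^sub>A\<close> maps solutions of the initial system to
  solutions of the transformed one (\<open>darboux_solution\<close>) and does not decrease \<open>J\<close> (\<open>jform_w_mono\<close>).
  Hence for every \<open>z\<close> in the upper half-plane outside the spectrum of \<open>A\<close> the solution with initial value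
  \<open>v\<^sub>A E\<^sub>1\<close> has \<open>J > 0\<close>; in particular the upper block of \<open>v\<^sub>A E\<^sub>1\<close> is invertible, and the quotient of
  the lower by the upper block is square integrable initial data.  The quotient is bounded, so it extends
  holomorphically across the finite spectrum of \<open>A\<close>, and the condition \<open>J \<ge> 0\<close> survives there by
  continuity of the fundamental solution in \<open>z\<close>.  This gives existence together with the formula.

  For uniqueness it suffices, by analytic continuation, to treat a nonempty open set of \<open>z\<close>, and it
  can be chosen such that \<open>Im (z\<^sub>1 z)\<close> exceeds an exponential growth rate of \<open>\<Lambda>\<close>.  If two Weyl values
  differed, there would be a square integrable solution \<open>v\<^sub>A y\<close> in which the growing exponential of \<open>y\<close>
  is present.  The matrix \<open>b y\<close> then grows like \<open>exp (x Im z\<^sub>1)\<close>; but \<open>b y\<close> differs from the square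
  integrable \<open>b w\<^sub>A y\<close> by \<open>\<i> b N q\<close> with \<open>N = j \<Lambda>\<^sup>*\<close> and \<open>q\<close> bounded (\<open>q_bounded\<close>), which grows at
  most like \<open>\<Lambda>\<close>, a contradiction (\<open>square_integrable_unique\<close>).
\<close>

section \<open>Rectangular complex matrices\<close>

lemma matrix_mult_add_right: "A ** (B + C) = A ** B + A ** (C :: complex ^ 'k ^ 'm)"
  by (simp add: matrix_matrix_mult_def vec_eq_iff sum.distrib algebra_simps)

lemma matrix_mult_add_left: "(A + B) ** C = A ** C + B ** (C :: complex ^ 'k ^ 'm)"
  by (simp add: matrix_matrix_mult_def vec_eq_iff sum.distrib algebra_simps)

lemma matrix_mult_diff_right: "A ** (B - C) = A ** B - A ** (C :: complex ^ 'k ^ 'm)"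
  by (simp add: matrix_matrix_mult_def vec_eq_iff sum_subtractf algebra_simps)

lemma matrix_mult_diff_left: "(A - B) ** C = A ** C - B ** (C :: complex ^ 'k ^ 'm)"
  by (simp add: matrix_matrix_mult_def vec_eq_iff sum_subtractf algebra_simps)

lemma matrix_mult_minus_right: "A ** (- B) = - (A ** (B :: complex ^ 'k ^ 'm))"
  by (simp add: matrix_matrix_mult_def vec_eq_iff sum_negf)

lemma matrix_mult_minus_left: "(- A) ** B = - (A ** (B :: complex ^ 'k ^ 'm))"
  by (simp add: matrix_matrix_mult_def vec_eq_iff sum_negf)

lemma matrix_mult_zero_right: "A ** (0 :: complex ^ 'k ^ 'm) = 0"
  by (simp add: matrix_matrix_mult_def vec_eq_iff)

lemma matrix_mult_zero_left: "(0 :: complex ^ 'm ^ 'l) ** (B :: complex ^ 'k ^ 'm) = 0"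
  by (simp add: matrix_matrix_mult_def vec_eq_iff)

lemma matrix_mult_cscale_right: "A ** (a *c B) = a *c (A ** (B :: complex ^ 'k ^ 'm))"
  by (simp add: matrix_matrix_mult_def vec_eq_iff cscale_def sum_distrib_left algebra_simps)

lemma matrix_mult_cscale_left: "(a *c A) ** B = a *c (A ** (B :: complex ^ 'k ^ 'm))"
  by (simp add: matrix_matrix_mult_def vec_eq_iff cscale_def sum_distrib_left algebra_simps)

lemma matrix_mult_mat_left: "mat a ** B = a *c (B :: complex ^ 'k ^ 'm)"
  by (simp add: matrix_matrix_mult_def vec_eq_iff cscale_def mat_def if_distrib if_distribR
      sum.delta' cong: if_cong)

lemmas matrix_mult_linear = matrix_mult_add_right matrix_mult_add_left matrix_mult_diff_right
  matrix_mult_diff_left matrix_mult_minus_right matrix_mult_minus_left matrix_mult_zero_right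
  matrix_mult_zero_left matrix_mult_cscale_right matrix_mult_cscale_left

lemma cscale_cscale: "a *c (b *c M) = (a * b) *c M"
  by (simp add: cscale_def vec_eq_iff)

lemma cscale_one: "1 *c M = M"
  by (simp add: cscale_def vec_eq_iff)

lemma cscale_zero: "0 *c M = 0" "a *c 0 = 0"
  by (simp_all add: cscale_def vec_eq_iff)

lemma cscale_add: "a *c (M + N) = a *c M + a *c N" "(a + b) *c M = a *c M + b *c M"
  by (simp_all add: cscale_def vec_eq_iff algebra_simps)

lemma cscale_diff: "a *c (M - N) = a *c M - a *c N" "(a - b) *c M = a *c M - b *c M"
  by (simp_all add: cscale_def vec_eq_iff algebra_simps)

lemma cscale_minus: "a *c (- M) = - (a *c M)" "(- a) *c M = - (a *c M)"
  by (simp_all add: cscale_def vec_eq_iff)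

lemma scaleR_eq_cscale: "r *\<^sub>R (M :: complex ^ 'k ^ 'm) = of_real r *c M"
  by (simp add: cscale_def vec_eq_iff) (simp add: scaleR_conv_of_real)

lemmas cscale_linear = cscale_cscale cscale_one cscale_zero cscale_add cscale_diff cscale_minus

lemma ctranspose_mult: "ctranspose (A ** B) = ctranspose B ** ctranspose (A :: complex ^ 'k ^ 'm)"
  by (simp add: ctranspose_def matrix_matrix_mult_def vec_eq_iff mult.commute)

lemma ctranspose_ctranspose: "ctranspose (ctranspose M) = M"
  by (simp add: ctranspose_def vec_eq_iff)

lemma ctranspose_add: "ctranspose (M + N) = ctranspose M + ctranspose N"
  by (simp add: ctranspose_def vec_eq_iff)

lemma ctranspose_diff: "ctranspose (M - N) = ctranspose M - ctranspose N"
  by (simp add: ctranspose_def vec_eq_iff)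

lemma ctranspose_minus: "ctranspose (- M) = - ctranspose M"
  by (simp add: ctranspose_def vec_eq_iff)

lemma ctranspose_cscale: "ctranspose (a *c M) = cnj a *c ctranspose M"
  by (simp add: ctranspose_def cscale_def vec_eq_iff)

lemma ctranspose_mat: "ctranspose (mat a) = mat (cnj a)"
  by (simp add: ctranspose_def mat_def vec_eq_iff)

lemma ctranspose_zero: "ctranspose 0 = 0"
  by (simp add: ctranspose_def vec_eq_iff)

lemmas ctranspose_simps = ctranspose_mult ctranspose_ctranspose ctranspose_add ctranspose_diff
  ctranspose_minus ctranspose_cscale ctranspose_mat ctranspose_zero

lemma matrix_inv_left: "invertible M \<Longrightarrow> matrix_inv M ** M = mat 1"
  and matrix_inv_right: "invertible M \<Longrightarrow> M ** matrix_inv M = mat 1"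
  for M :: "complex ^ 'n ^ 'n"
  unfolding matrix_inv_def invertible_def by (metis (mono_tags, lifting) someI_ex)+

lemma matrix_inv_left_cancel: "invertible M \<Longrightarrow> matrix_inv M ** (M ** X) = X"
  and matrix_inv_right_cancel: "invertible M \<Longrightarrow> M ** (matrix_inv M ** X) = X"
  for M :: "complex ^ 'n ^ 'n" and X :: "complex ^ 'k ^ 'n"
  by (simp_all add: matrix_mul_assoc matrix_inv_left matrix_inv_right)

lemma invertible_left: "N ** M = mat 1 \<Longrightarrow> invertible M"
  for M :: "complex ^ 'n ^ 'n"
  using invertible_left_inverse by blast

lemma matrix_inv_unique: "N ** M = mat 1 \<Longrightarrow> matrix_inv M = N"
  for M :: "complex ^ 'n ^ 'n"
  using matrix_mul_assoc[of N M "matrix_inv M"] by (simp add: matrix_inv_right[OF invertible_left])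

lemma ctranspose_matrix_inv:
  "invertible M \<Longrightarrow> ctranspose (matrix_inv M) = matrix_inv (ctranspose M)"
  for M :: "complex ^ 'n ^ 'n"
  by (rule matrix_inv_unique[symmetric])
    (simp add: ctranspose_mult[symmetric] matrix_inv_right ctranspose_mat)

text \<open>Testing with square matrices instead of vectors fits the arguments below, in which all solutions are
  matrix-valued; a vector \<open>u\<close> is tested by the matrix all of whose columns are \<open>u\<close>.\<close>
lemma invertible_if_injective:
  fixes M :: "complex ^ 'n ^ 'n"
  assumes "\<And>U :: complex ^ 'n ^ 'n. M ** U = 0 \<Longrightarrow> U = 0"
  shows "invertible M"
  unfolding invertible_left_inverse matrix_left_invertible_ker
proof (intro allI impI)
  fix u :: "complex ^ 'n" assume "M *v u = 0"
  then have "M ** (\<chi> i k. u $ i) = (0 :: complex ^ 'n ^ 'n)"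
    by (simp add: matrix_matrix_mult_def matrix_vector_mult_def vec_eq_iff)
  then have "(\<chi> i k. u $ i) = (0 :: complex ^ 'n ^ 'n)" by (rule assms)
  then show "u = 0" by (simp add: vec_eq_iff)
qed

text \<open>Cramer's rule turns continuity and holomorphy of the inverse into properties of determinants.\<close>
lemma matrix_inv_component:
  fixes M :: "complex ^ 'n ^ 'n"
  assumes "invertible M"
  shows "matrix_inv M $ k $ l =
    det (\<chi> i j. if j = k then (if i = l then 1 else 0) else M $ i $ j) / det M"
proof -
  have "M *v column l (matrix_inv M) = column l (mat 1)"
    using assms by (simp add: vec_eq_iff matrix_vector_mult_def column_def
        matrix_inv_right[OF assms, symmetric] matrix_matrix_mult_def)
  then have "column l (matrix_inv M) =
      (\<chi> k. det (\<chi> i j. if j = k then column l (mat 1) $ i else M $ i $ j) / det M)"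
    using cramer[of M] assms by (simp add: invertible_det_nz)
  then have "column l (matrix_inv M) $ k = \<dots> $ k" by simp
  moreover have "column l (mat 1) $ i = (if i = l then 1 else (0 :: complex))" for i
    by (simp add: column_def mat_def)
  ultimately show ?thesis
    by (simp only: vec_lambda_beta) (simp add: column_def)
qed

section \<open>The Frobenius inner product\<close>

text \<open>The inner product that the type of matrices inherits from its entries is \<open>Re tr (X\<^sup>* Y)\<close>, so
  multiplication by \<open>A\<close> and by \<open>A\<^sup>*\<close> are adjoint to each other, and all quadratic forms can be
  handled by traces.\<close>
lemma inner_matrix: "inner X Y = Re (\<Sum>i\<in>UNIV. \<Sum>k\<in>UNIV. cnj (X $ i $ k) * Y $ i $ k)"
  for X Y :: "complex ^ 'k ^ 'm"
  by (simp add: inner_vec_def inner_complex_def)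

lemma inner_mult_left: "inner (A ** X) Y = inner X (ctranspose A ** Y)"
  for X :: "complex ^ 'k ^ 'l" and Y :: "complex ^ 'k ^ 'm"
proof -
  have "(\<Sum>i\<in>UNIV. \<Sum>k\<in>UNIV. cnj ((A ** X) $ i $ k) * Y $ i $ k)
      = (\<Sum>i\<in>UNIV. \<Sum>k\<in>UNIV. \<Sum>l\<in>UNIV. cnj (A $ i $ l) * cnj (X $ l $ k) * Y $ i $ k)"
    by (simp add: matrix_matrix_mult_def sum_distrib_right)
  also have "\<dots> = (\<Sum>i\<in>UNIV. \<Sum>l\<in>UNIV. \<Sum>k\<in>UNIV. cnj (A $ i $ l) * cnj (X $ l $ k) * Y $ i $ k)"
    by (intro sum.cong refl sum.swap)
  also have "\<dots> = (\<Sum>l\<in>UNIV. \<Sum>i\<in>UNIV. \<Sum>k\<in>UNIV. cnj (A $ i $ l) * cnj (X $ l $ k) * Y $ i $ k)"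
    by (rule sum.swap)
  also have "\<dots> = (\<Sum>l\<in>UNIV. \<Sum>k\<in>UNIV. \<Sum>i\<in>UNIV. cnj (A $ i $ l) * cnj (X $ l $ k) * Y $ i $ k)"
    by (intro sum.cong refl sum.swap)
  also have "\<dots> = (\<Sum>l\<in>UNIV. \<Sum>k\<in>UNIV. cnj (X $ l $ k) * (ctranspose A ** Y) $ l $ k)"
    by (simp add: matrix_matrix_mult_def ctranspose_def sum_distrib_left mult_ac)
  finally show ?thesis by (simp only: inner_matrix)
qed

lemma inner_mult_right: "inner X (A ** Y) = inner (ctranspose A ** X) Y"
  for X :: "complex ^ 'k ^ 'l" and Y :: "complex ^ 'k ^ 'm"
  by (simp add: inner_mult_left ctranspose_ctranspose)

lemma inner_cscale_left: "inner (a *c X) Y = inner X (cnj a *c Y)"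
  by (simp add: inner_matrix cscale_def mult_ac)

lemma norm_matrix_squared: "(norm X)\<^sup>2 = (\<Sum>i\<in>UNIV. \<Sum>k\<in>UNIV. (cmod (X $ i $ k))\<^sup>2)"
  for X :: "complex ^ 'k ^ 'm"
  by (simp add: power2_norm_eq_inner inner_vec_def)

lemma inner_cscale_self: "inner X (a *c X) = Re a * (norm X)\<^sup>2"
  for X :: "complex ^ 'k ^ 'm"
proof -
  have "cnj x * (a * x) = a * of_real ((cmod x)\<^sup>2)" for x :: complex
    by (metis complex_norm_square mult.left_commute mult.commute)
  then have "(\<Sum>i\<in>UNIV. \<Sum>k\<in>UNIV. cnj (X $ i $ k) * (a *c X) $ i $ k)
      = a * of_real (\<Sum>i\<in>UNIV. \<Sum>k\<in>UNIV. (cmod (X $ i $ k))\<^sup>2)"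
    by (simp only: cscale_def vec_lambda_beta of_real_sum sum_distrib_left)
  moreover have "(norm X)\<^sup>2 = (\<Sum>i\<in>UNIV. \<Sum>k\<in>UNIV. (cmod (X $ i $ k))\<^sup>2)"
    by (rule norm_matrix_squared)
  ultimately show ?thesis by (simp add: inner_matrix)
qed

lemma norm_cscale: "norm (a *c X) = cmod a * norm X"
proof -
  have "Re (cnj a * a) = (cmod a)\<^sup>2"
    by (simp add: cmod_power2) (simp add: power2_eq_square)
  then have "(norm (a *c X))\<^sup>2 = (cmod a * norm X)\<^sup>2"
    by (simp only: power2_norm_eq_inner[of "a *c X"] inner_cscale_left cscale_cscale
        inner_cscale_self power_mult_distrib)
  then show ?thesis by (simp add: power2_eq_iff_nonneg)
qed

lemma norm_ctranspose: "norm (ctranspose X) = norm X"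
proof -
  have "(norm (ctranspose X))\<^sup>2 = (norm X)\<^sup>2"
    unfolding norm_matrix_squared by (subst sum.swap) (simp add: ctranspose_def)
  then show ?thesis by (simp add: power2_eq_iff_nonneg)
qed

text \<open>The Cauchy--Schwarz inequality for each entry of the product.\<close>
lemma norm_matrix_mult_le: "norm (M ** X) \<le> norm M * norm X"
  for M :: "complex ^ 'k ^ 'm" and X :: "complex ^ 'l ^ 'k"
proof -
  have "(norm (M ** X))\<^sup>2 \<le>
      (\<Sum>i\<in>UNIV. \<Sum>l\<in>UNIV. (\<Sum>k\<in>UNIV. (cmod (M $ i $ k))\<^sup>2) * (\<Sum>k\<in>UNIV. (cmod (X $ k $ l))\<^sup>2))"
    unfolding norm_matrix_squared
  proof (intro sum_mono)
    fix i l
    have "cmod ((M ** X) $ i $ l) \<le> (\<Sum>k\<in>UNIV. cmod (M $ i $ k) * cmod (X $ k $ l))"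
      by (auto simp: matrix_matrix_mult_def norm_mult intro: sum_norm_le)
    then have "(cmod ((M ** X) $ i $ l))\<^sup>2 \<le> (\<Sum>k\<in>UNIV. cmod (M $ i $ k) * cmod (X $ k $ l))\<^sup>2"
      by (rule power_mono) simp
    also have "\<dots> \<le> (\<Sum>k\<in>UNIV. (cmod (M $ i $ k))\<^sup>2) * (\<Sum>k\<in>UNIV. (cmod (X $ k $ l))\<^sup>2)"
      by (rule Cauchy_Schwarz_ineq_sum)
    finally show "(cmod ((M ** X) $ i $ l))\<^sup>2 \<le>
        (\<Sum>k\<in>UNIV. (cmod (M $ i $ k))\<^sup>2) * (\<Sum>k\<in>UNIV. (cmod (X $ k $ l))\<^sup>2)" .
  qed
  also have "\<dots> = (norm M * norm X)\<^sup>2"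
    unfolding power_mult_distrib norm_matrix_squared
    by (simp only: sum_product[symmetric])
      (subst (2) sum.swap, simp only:)
  finally show ?thesis
    by (simp add: power2_le_iff_abs_le)
qed

lemma eq_if_inner_eq: "(\<And>X. inner X Y = inner X Z) \<Longrightarrow> Y = Z"
  for Y Z :: "'a :: real_inner"
  by (metis inner_diff_right inner_eq_zero_iff right_minus_eq)

lemma bounded_bilinear_matrix_mult:
  "bounded_bilinear ((**) :: complex ^ 'k ^ 'm \<Rightarrow> complex ^ 'l ^ 'k \<Rightarrow> complex ^ 'l ^ 'm)"
  unfolding bilinear_conv_bounded_bilinear[symmetric] bilinear_def
  by (auto intro!: linearI simp: matrix_mult_linear scaleR_eq_cscale)

lemma bounded_linear_ctranspose: "bounded_linear (ctranspose :: complex ^ 'k ^ 'm \<Rightarrow> _)"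
  by (intro linear_conv_bounded_linear[THEN iffD1] linearI)
    (simp_all add: ctranspose_simps scaleR_eq_cscale)

lemma bounded_linear_cscale: "bounded_linear ((*c) a :: complex ^ 'k ^ 'm \<Rightarrow> _)"
  by (intro linear_conv_bounded_linear[THEN iffD1] linearI)
    (simp_all add: cscale_linear scaleR_eq_cscale mult_ac)

lemma bounded_bilinear_cscale: "bounded_bilinear ((*c) :: complex \<Rightarrow> complex ^ 'k ^ 'm \<Rightarrow> _)"
  unfolding bilinear_conv_bounded_bilinear[symmetric] bilinear_def
  by (auto intro!: linearI simp: cscale_linear scaleR_eq_cscale mult_ac scaleR_conv_of_real)

lemmas has_vector_derivative_matrix_mult =
  bounded_bilinear.has_vector_derivative[OF bounded_bilinear_matrix_mult]
lemmas has_vector_derivative_ctranspose =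
  bounded_linear.has_vector_derivative[OF bounded_linear_ctranspose]
lemmas has_vector_derivative_cscale =
  bounded_linear.has_vector_derivative[OF bounded_linear_cscale]
lemmas has_vector_derivative_inner =
  bounded_bilinear.has_vector_derivative[OF bounded_bilinear_inner]
lemmas continuous_on_matrix_mult [continuous_intros] =
  bounded_bilinear.continuous_on[OF bounded_bilinear_matrix_mult]
lemmas continuous_on_ctranspose [continuous_intros] =
  bounded_linear.continuous_on[OF bounded_linear_ctranspose]
lemmas continuous_on_cscale [continuous_intros] =
  bounded_bilinear.continuous_on[OF bounded_bilinear_cscale]

lemma has_vector_derivative_matrix_mult_const_left:
  "(Y has_vector_derivative Y') F \<Longrightarrow> ((\<lambda>x. M ** Y x) has_vector_derivative M ** Y') F"
  for M :: "complex ^ 'k ^ 'm"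
  by (rule bounded_linear.has_vector_derivative[OF
        bounded_bilinear.bounded_linear_right[OF bounded_bilinear_matrix_mult]])

lemma has_vector_derivative_matrix_mult_const_right:
  "(Y has_vector_derivative Y') F \<Longrightarrow> ((\<lambda>x. Y x ** M) has_vector_derivative Y' ** M) F"
  for M :: "complex ^ 'k ^ 'm"
  by (rule bounded_linear.has_vector_derivative[OF
        bounded_bilinear.bounded_linear_left[OF bounded_bilinear_matrix_mult]])

lemma continuous_on_det:
  fixes M :: "'a :: topological_space \<Rightarrow> complex ^ 'n ^ 'n"
  assumes "continuous_on U M"
  shows "continuous_on U (\<lambda>x. det (M x))"
  unfolding det_def by (intro continuous_intros assms)

lemma continuous_on_matrixI:
  fixes M :: "'a :: topological_space \<Rightarrow> complex ^ 'k ^ 'm"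
  assumes "\<And>i k. continuous_on U (\<lambda>x. M x $ i $ k)"
  shows "continuous_on U M"
  using assms unfolding continuous_on_def by (blast intro: vec_tendstoI)

lemma continuous_on_matrix_inv:
  fixes M :: "'a :: topological_space \<Rightarrow> complex ^ 'n ^ 'n"
  assumes "continuous_on U M" and "\<And>x. x \<in> U \<Longrightarrow> invertible (M x)"
  shows "continuous_on U (\<lambda>x. matrix_inv (M x))"
proof -
  have "continuous_on U (\<lambda>x. matrix_inv (M x) $ k $ l)" for k l
  proof (rule continuous_on_eq)
    have "continuous_on U (\<lambda>x. if j = k then if i = l then 1 else 0 else M x $ i $ j)" for i j
      by (cases "j = k") (auto intro!: continuous_intros assms(1))
    then show "continuous_on U (\<lambda>x.
        det (\<chi> i j. if j = k then (if i = l then 1 else 0) else M x $ i $ j) / det (M x))"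
      by (intro continuous_on_divide continuous_on_det continuous_on_vec_lambda assms(1))
        (use assms in \<open>auto simp: invertible_det_nz\<close>)
  qed (simp add: matrix_inv_component assms(2))
  then show ?thesis by (rule continuous_on_matrixI)
qed

lemma has_vector_derivative_iff_quotient:
  "(f has_vector_derivative D) (at x within U) \<longleftrightarrow>
    ((\<lambda>y. (1 / (y - x)) *\<^sub>R (f y - f x)) \<longlongrightarrow> D) (at x within U)"
proof -
  have eq: "norm ((1 / norm (y - x)) *\<^sub>R (f y - (f x + (y - x) *\<^sub>R D)))
      = norm ((1 / (y - x)) *\<^sub>R (f y - f x) - D)" if "y \<noteq> x" for y
  proof -
    have "(1 / (y - x)) *\<^sub>R (f y - (f x + (y - x) *\<^sub>R D)) = (1 / (y - x)) *\<^sub>R (f y - f x) - D"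
      using that by (simp only: diff_diff_eq[symmetric] scaleR_diff_right scaleR_scaleR) simp
    moreover have "norm ((1 / norm (y - x)) *\<^sub>R v) = norm ((1 / (y - x)) *\<^sub>R v)" for v :: 'a
      by simp
    ultimately show ?thesis by (simp only:)
  qed
  have "(f has_vector_derivative D) (at x within U) \<longleftrightarrow>
    ((\<lambda>y. norm ((1 / norm (y - x)) *\<^sub>R (f y - (f x + (y - x) *\<^sub>R D)))) \<longlongrightarrow> 0) (at x within U)"
    by (simp add: has_vector_derivative_def has_derivative_within bounded_linear_scaleR_left
        tendsto_norm_zero_iff del: norm_scaleR)
  also have "\<dots> \<longleftrightarrow> ((\<lambda>y. norm ((1 / (y - x)) *\<^sub>R (f y - f x) - D)) \<longlongrightarrow> 0) (at x within U)"
    by (intro filterlim_cong refl) (unfold eventually_at_filter, intro always_eventually allI impI eq)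
  finally show ?thesis
    by (simp add: tendsto_norm_zero_iff Lim_null[symmetric])
qed

text \<open>The difference quotient of the inverse is
  \<open>- M(y)\<^sup>-\<^sup>1 (M(y) - M(x)) / (y - x) M(x)\<^sup>-\<^sup>1\<close>, whose limit follows from continuity of the inverse.\<close>
lemma has_vector_derivative_matrix_inv:
  fixes M :: "real \<Rightarrow> complex ^ 'n ^ 'n"
  assumes M: "(M has_vector_derivative M') (at x within U)"
    and cont: "continuous_on U M" and inv: "\<And>x. x \<in> U \<Longrightarrow> invertible (M x)" and x: "x \<in> U"
  shows "((\<lambda>x. matrix_inv (M x)) has_vector_derivative - (matrix_inv (M x) ** M' ** matrix_inv (M x)))
    (at x within U)"
proof -
  interpret mult: bounded_bilinear "(**) :: complex ^ 'n ^ 'n \<Rightarrow> complex ^ 'n ^ 'n \<Rightarrow> complex ^ 'n ^ 'n"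
    by (rule bounded_bilinear_matrix_mult)
  let ?T = "\<lambda>x. matrix_inv (M x)"
  have lim: "((\<lambda>y. (1 / (y - x)) *\<^sub>R (M y - M x)) \<longlongrightarrow> M') (at x within U)"
    using M by (simp only: has_vector_derivative_iff_quotient)
  have "((\<lambda>y. ?T y) \<longlongrightarrow> ?T x) (at x within U)"
    using continuous_on_matrix_inv[OF cont inv] x by (simp add: continuous_on_def)
  then have "((\<lambda>y. - (?T y ** ((1 / (y - x)) *\<^sub>R (M y - M x)) ** ?T x))
      \<longlongrightarrow> - (?T x ** M' ** ?T x)) (at x within U)"
    by (intro tendsto_intros mult.tendsto lim)
  then show ?thesis
    unfolding has_vector_derivative_iff_quotient
  proof (rule Lim_transform_eventually)
    have "- (?T y ** ((1 / (y - x)) *\<^sub>R (M y - M x)) ** ?T x)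
      = (1 / (y - x)) *\<^sub>R (?T y - ?T x)" if "y \<in> U" for y
    proof -
      have "- (?T y ** (M y - M x) ** ?T x) = ?T y - ?T x"
        by (simp add: matrix_mult_linear matrix_mul_assoc[symmetric] matrix_inv_right inv x
            matrix_inv_left_cancel that)
      moreover have "?T y ** ((1 / (y - x)) *\<^sub>R (M y - M x)) ** ?T x
          = (1 / (y - x)) *\<^sub>R (?T y ** (M y - M x) ** ?T x)"
        by (simp only: mult.scaleR_left mult.scaleR_right)
      ultimately show ?thesis
        by (simp only: scaleR_minus_right[symmetric])
    qed
    then show "\<forall>\<^sub>F y in at x within U. - (?T y ** ((1 / (y - x)) *\<^sub>R (M y - M x)) ** ?T x)
        = (1 / (y - x)) *\<^sub>R (?T y - ?T x)"
      by (auto simp: eventually_at_filter)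
  qed
qed

lemma holomorphic_on_det:
  fixes M :: "complex \<Rightarrow> complex ^ 'n ^ 'n"
  assumes "\<And>i j. (\<lambda>z. M z $ i $ j) holomorphic_on U"
  shows "(\<lambda>z. det (M z)) holomorphic_on U"
  unfolding det_def by (intro holomorphic_intros assms)

lemma holomorphic_on_matrix_inv:
  fixes M :: "complex \<Rightarrow> complex ^ 'n ^ 'n"
  assumes "\<And>i j. (\<lambda>z. M z $ i $ j) holomorphic_on U" and "\<And>z. z \<in> U \<Longrightarrow> invertible (M z)"
  shows "(\<lambda>z. matrix_inv (M z) $ k $ l) holomorphic_on U"
proof (rule holomorphic_transform)
  have "(\<lambda>z. if j = k then if i = l then 1 else 0 else M z $ i $ j) holomorphic_on U" for i j
    by (cases "j = k") (auto intro!: holomorphic_intros assms(1))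
  then show "(\<lambda>z. det (\<chi> i j. if j = k then (if i = l then 1 else 0) else M z $ i $ j) / det (M z))
      holomorphic_on U"
    using assms by (intro holomorphic_intros holomorphic_on_det) (auto simp: invertible_det_nz)
qed (simp add: matrix_inv_component assms(2))

lemma holomorphic_on_matrix_mult:
  fixes M :: "complex \<Rightarrow> complex ^ 'k ^ 'm" and N :: "complex \<Rightarrow> complex ^ 'l ^ 'k"
  assumes "\<And>i j. (\<lambda>z. M z $ i $ j) holomorphic_on U" "\<And>i j. (\<lambda>z. N z $ i $ j) holomorphic_on U"
  shows "(\<lambda>z. (M z ** N z) $ i $ j) holomorphic_on U"
  unfolding matrix_matrix_mult_def by (simp, intro holomorphic_intros assms)

text \<open>\<open>det (A - z)\<close> is the value at \<open>z\<close> of a determinant over the ring of polynomials, which is not the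
  zero polynomial because it does not vanish at \<open>0\<close>.\<close>
lemma finite_not_invertible_shift:
  fixes A :: "complex ^ 'n ^ 'n"
  assumes "invertible A"
  shows "finite {z. \<not> invertible (A - mat z)}"
proof -
  define Q :: "complex poly ^ 'n ^ 'n" where "Q = (\<chi> i j. if i = j then [:A $ i $ j, -1:] else [:A $ i $ j:])"
  have det_Q: "poly (det Q) z = det (A - mat z)" for z
  proof -
    have "poly (Q $ i $ j) z = (A - mat z) $ i $ j" for i j
      by (simp add: Q_def mat_def)
    then show ?thesis
      by (simp add: det_def poly_sum poly_prod)
  qed
  have "poly (det Q) 0 \<noteq> 0"
    using assms det_Q[of 0] by (simp add: invertible_det_nz)
  then have "det Q \<noteq> 0" by force
  then have "finite {z. poly (det Q) z = 0}" by (rule poly_roots_finite)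
  then show ?thesis
    by (simp add: det_Q invertible_det_nz)
qed

section \<open>Block matrices and the signature matrix\<close>

lemma sum_UNIV_sum: "(\<Sum>s\<in>UNIV. f s) = (\<Sum>i\<in>UNIV. f (Inl i)) + (\<Sum>l\<in>UNIV. f (Inr l))"
  for f :: "'m::finite + 'l::finite \<Rightarrow> 'a :: comm_monoid_add"
  by (subst UNIV_Plus_UNIV[symmetric], subst sum.Plus) auto

lemma block_eq_iff: "vstack M N = vstack M' N' \<longleftrightarrow> M = M' \<and> N = N'"
  by (auto simp: vstack_def vec_eq_iff split_sum_all)

lemma vstack_blocks: "\<exists>M N. Y = vstack M N"
proof -
  have "Y = vstack (\<chi> i. Y $ Inl i) (\<chi> i. Y $ Inr i)"
    by (simp add: vstack_def vec_eq_iff split: sum.split)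
  then show ?thesis by blast
qed

lemma hstack_mult_vstack: "hstack A B ** vstack M N = A ** M + B ** N"
  for M :: "complex ^ 'k ^ 'm" and N :: "complex ^ 'k ^ 'l"
  by (simp add: hstack_def vstack_def matrix_matrix_mult_def vec_eq_iff sum_UNIV_sum)

lemma vstack_mult: "vstack M N ** X = vstack (M ** X) (N ** X)"
  by (simp add: vstack_def matrix_matrix_mult_def vec_eq_iff split: sum.split)

lemma vstack_add: "vstack M N + vstack M' N' = vstack (M + M') (N + N')"
  by (simp add: vstack_def vec_eq_iff split: sum.split)

lemma vstack_diff: "vstack M N - vstack M' N' = vstack (M - M') (N - N')"
  by (simp add: vstack_def vec_eq_iff split: sum.split)

lemma vstack_cscale: "a *c vstack M N = vstack (a *c M) (a *c N)"
  by (simp add: vstack_def cscale_def vec_eq_iff split: sum.split)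

lemma vstack_zero: "vstack 0 0 = 0"
  by (simp add: vstack_def vec_eq_iff split: sum.split)

lemma ctranspose_hstack: "ctranspose (hstack M N) = vstack (ctranspose M) (ctranspose N)"
  by (simp add: vstack_def hstack_def ctranspose_def vec_eq_iff split: sum.split)

lemma ctranspose_vstack: "ctranspose (vstack M N) = hstack (ctranspose M) (ctranspose N)"
  by (simp add: vstack_def hstack_def ctranspose_def vec_eq_iff split: sum.split)

lemma inner_vstack: "inner (vstack M N) (vstack M' N') = inner M M' + inner N N'"
  by (simp add: vstack_def inner_vec_def sum_UNIV_sum)

lemma jmat_mult_vstack: "jmat ** vstack M N = vstack M (- N)"
  by (simp add: jmat_def vstack_mult hstack_mult_vstack matrix_mult_linear)

lemma jmat_jmat: "jmat ** (jmat ** Y) = Y"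
  using vstack_blocks[of Y] by (auto simp: jmat_mult_vstack)

lemma jmat_mult_jmat: "jmat ** jmat = mat 1"
  using jmat_jmat[of "mat 1"] by simp

lemma ctranspose_jmat: "ctranspose jmat = jmat"
  by (simp add: jmat_def ctranspose_vstack ctranspose_hstack ctranspose_simps)
    (simp add: vstack_def hstack_def vec_eq_iff split: sum.split)

text \<open>The trace form of the signature matrix.  One number per solution, instead of a Hermitian matrix,
  suffices for boundedness, integrability and injectivity.\<close>
definition jform :: "complex ^ 'k ^ ('p::finite + 'p) \<Rightarrow> real"
  where "jform Y = inner Y (jmat ** Y)"

lemma jform_vstack: "jform (vstack M N) = (norm M)\<^sup>2 - (norm N)\<^sup>2"
  by (simp add: jform_def jmat_mult_vstack inner_vstack power2_norm_eq_inner)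

section \<open>Calculus on the half-line\<close>

lemma at_within_half_line:
  fixes x :: real
  assumes "0 \<le> x" "x < R"
  shows "at x within {0..} = at x within {0..R}"
  by (rule at_within_nhd[of x "{..<R}"]) (use assms in auto)

lemma at_within_half_line_interior: "0 < x \<Longrightarrow> at x within {0..} = at (x::real)"
  by (rule at_within_nhd[of x "{0<..}"]) auto

lemma has_vector_derivative_continuous_on:
  assumes "\<And>x. x \<in> U \<Longrightarrow> (f has_vector_derivative f' x) (at x within U)"
  shows "continuous_on U f"
  using assms by (auto simp: continuous_on_eq_continuous_within intro: has_vector_derivative_continuous)

text \<open>A comparison principle on the half-line, in which the derivatives are one-sided at \<open>0\<close>.  Monotonicity,
  constancy and the bounds for Picard iterates are all instances.\<close>
lemma norm_diff_le_by_derivative: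
  fixes f :: "real \<Rightarrow> 'a :: real_normed_vector" and \<phi> :: "real \<Rightarrow> real"
  assumes f: "\<And>x. 0 \<le> x \<Longrightarrow> (f has_vector_derivative f' x) (at x within {0..})"
    and \<phi>: "\<And>x. 0 \<le> x \<Longrightarrow> (\<phi> has_vector_derivative \<phi>' x) (at x within {0..})"
    and bound: "\<And>x. a < x \<Longrightarrow> x < b \<Longrightarrow> norm (f' x) \<le> \<phi>' x"
    and "0 \<le> a" "a \<le> b"
  shows "norm (f b - f a) \<le> \<phi> b - \<phi> a"
proof (cases "b = a")
  case False
  have "continuous_on {0..} f" "continuous_on {0..} \<phi>"
    using f \<phi> by (auto intro!: has_vector_derivative_continuous_on)
  then have "continuous_on {a..b} f" "continuous_on {a..b} \<phi>"
    using \<open>0 \<le> a\<close> by (auto elim: continuous_on_subset)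
  then show ?thesis
    using f \<phi> bound False \<open>0 \<le> a\<close> \<open>a \<le> b\<close>
    by (intro differentiable_bound_general[of a b f \<phi> f' \<phi>'])
      (auto simp: at_within_half_line_interior[symmetric])
qed simp

lemma nondecreasing_by_derivative:
  fixes \<phi> :: "real \<Rightarrow> real"
  assumes "\<And>x. 0 \<le> x \<Longrightarrow> (\<phi> has_vector_derivative \<phi>' x) (at x within {0..})"
    and "\<And>x. 0 \<le> x \<Longrightarrow> 0 \<le> \<phi>' x" and "0 \<le> b"
  shows "\<phi> 0 \<le> \<phi> b"
  using norm_diff_le_by_derivative[of "\<lambda>_. 0 :: real" "\<lambda>_. 0" \<phi> \<phi>' 0 b] assms by auto

lemma constant_by_derivative:
  fixes f :: "real \<Rightarrow> 'a :: real_normed_vector"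
  assumes "\<And>x. 0 \<le> x \<Longrightarrow> (f has_vector_derivative 0) (at x within {0..})" and "0 \<le> b"
  shows "f b = f 0"
  using norm_diff_le_by_derivative[of f "\<lambda>_. 0" "\<lambda>_. 0" "\<lambda>_. 0" 0 b] assms by auto

text \<open>Monotone convergence for the truncations of \<open>g\<close> to \<open>[0, n]\<close>.\<close>
lemma integrable_if_primitive_bounded:
  fixes g G :: "real \<Rightarrow> real"
  assumes G: "\<And>x. 0 \<le> x \<Longrightarrow> (G has_vector_derivative g x) (at x within {0..})"
    and nonneg: "\<And>x. 0 \<le> x \<Longrightarrow> 0 \<le> g x" and bound: "\<And>x. 0 \<le> x \<Longrightarrow> G x \<le> C"
  shows "g integrable_on {0..}"
proof -
  define f where "f n x = (if x \<in> {0..real n} then g x else 0)" for n :: nat and x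
  have int: "(f n has_integral (G n - G 0)) {0..}" for n
  proof -
    have "(g has_integral (G n - G 0)) {0..real n}"
      by (rule fundamental_theorem_of_calculus)
        (use G in \<open>auto intro: has_vector_derivative_within_subset[of _ _ _ "{0..}"]\<close>)
    then show ?thesis
      unfolding f_def by (subst has_integral_restrict) auto
  qed
  have "g integrable_on {0..} \<and> (\<lambda>n. integral {0..} (f n)) \<longlonglongrightarrow> integral {0..} g"
  proof (rule monotone_convergence_increasing)
    show "f n integrable_on {0..}" for n using int by blast
    show "f n x \<le> f (Suc n) x" if "x \<in> {0..}" for n x
      using that nonneg by (auto simp: f_def)
    show "(\<lambda>n. f n x) \<longlonglongrightarrow> g x" if "x \<in> {0..}" for x
    proof (rule tendsto_eventually)
      obtain m :: nat where "x \<le> m" using real_arch_simple by blast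
      then show "\<forall>\<^sub>F n in sequentially. f n x = g x"
        using that unfolding f_def eventually_sequentially by (auto intro!: exI[of _ m])
    qed
    have "\<bar>G n - G 0\<bar> \<le> \<bar>C - G 0\<bar>" for n :: nat
      using bound[of n] nondecreasing_by_derivative[of G g "real n"] G nonneg by auto
    then show "bounded (range (\<lambda>n. integral {0..} (f n)))"
      by (auto simp: bounded_iff integral_unique[OF int] intro!: exI[of _ "\<bar>C - G 0\<bar>"])
  qed
  then show ?thesis by blast
qed

lemma primitive_bounded_if_integrable:
  fixes g G :: "real \<Rightarrow> real"
  assumes G: "\<And>x. 0 \<le> x \<Longrightarrow> (G has_vector_derivative g x) (at x within {0..})"
    and nonneg: "\<And>x. 0 \<le> x \<Longrightarrow> 0 \<le> g x" and "g integrable_on {0..}" and "0 \<le> x"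
  shows "G x - G 0 \<le> integral {0..} g"
proof -
  have "(g has_integral (G x - G 0)) {0..x}"
    by (rule fundamental_theorem_of_calculus)
      (use G \<open>0 \<le> x\<close> in \<open>auto intro: has_vector_derivative_within_subset[of _ _ _ "{0..}"]\<close>)
  then show ?thesis
    using integral_subset_le[of "{0..x}" "{0..}" g] assms by (auto simp: has_integral_iff)
qed

section \<open>Linear systems depending on a parameter\<close>

text \<open>The coefficient of \<open>z\<^sup>k\<close> in the solution of \<open>W' = z K W\<close>, \<open>W 0 = 1\<close>: a \<open>k\<close>-fold iterated integral.\<close>
primrec picard_term :: "(real \<Rightarrow> complex ^ 'n ^ 'n) \<Rightarrow> nat \<Rightarrow> real \<Rightarrow> complex ^ 'n ^ 'n" where
  "picard_term K 0 x = mat 1"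
| "picard_term K (Suc k) x = integral {0..x} (\<lambda>t. K t ** picard_term K k t)"

declare picard_term.simps(2) [simp del]

lemma picard_term_derivative:
  assumes K: "continuous_on {0..} K"
  shows "0 \<le> x \<Longrightarrow> (picard_term K (Suc k) has_vector_derivative K x ** picard_term K k x)
    (at x within {0..})"
    and "continuous_on {0..} (picard_term K k)"
proof -
  have step: "(picard_term K (Suc k) has_vector_derivative K x ** picard_term K k x)
      (at x within {0..})" if cont: "continuous_on {0..} (picard_term K k)" and "0 \<le> x" for k x
  proof -
    have "continuous_on {0..x+1} (\<lambda>t. K t ** picard_term K k t)"
      using K cont by (auto intro!: continuous_intros elim: continuous_on_subset)
    then have "((\<lambda>u. integral {0..u} (\<lambda>t. K t ** picard_term K k t)) has_vector_derivative
        K x ** picard_term K k x) (at x within {0..x+1})"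
      by (rule integral_has_vector_derivative) (use \<open>0 \<le> x\<close> in auto)
    moreover have "picard_term K (Suc k) = (\<lambda>u. integral {0..u} (\<lambda>t. K t ** picard_term K k t))"
      by (simp add: fun_eq_iff picard_term.simps(2))
    ultimately show ?thesis
      using \<open>0 \<le> x\<close> by (simp only: at_within_half_line[of x "x+1"])
  qed
  show cont: "continuous_on {0..} (picard_term K k)" for k
  proof (induction k)
    case (Suc k)
    then show ?case
      using step by (intro has_vector_derivative_continuous_on[of _ _ "\<lambda>x. K x ** picard_term K k x"]) auto
  qed (simp add: continuous_intros)
  show "0 \<le> x \<Longrightarrow> (picard_term K (Suc k) has_vector_derivative K x ** picard_term K k x)
    (at x within {0..})"
    using step[OF cont] .
qed

lemma picard_term_bound:
  fixes K :: "real \<Rightarrow> complex ^ 'n ^ 'n"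
  assumes K: "continuous_on {0..} K" and "0 \<le> M"
    and M: "\<And>t (Y :: complex ^ 'n ^ 'n). t \<in> {0..R} \<Longrightarrow> norm (K t ** Y) \<le> M * norm Y"
  shows "x \<in> {0..R} \<Longrightarrow> norm (picard_term K k x) \<le> norm (mat 1 :: complex ^ 'n ^ 'n) * (M * x) ^ k / fact k"
proof (induction k arbitrary: x)
  case (Suc k)
  let ?B = "norm (mat 1 :: complex ^ 'n ^ 'n)"
  have "((\<lambda>x. ?B * (M * x) ^ Suc k / fact (Suc k)) has_vector_derivative
      M * (?B * (M * t) ^ k / fact k)) (at t within {0..})" for t
  proof -
    have "((\<lambda>x. ?B * (M * x) ^ Suc k / fact (Suc k)) has_real_derivative
        ?B * (real (Suc k) * (M * t) ^ k * M) / fact (Suc k)) (at t within {0..})"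
      by (auto intro!: derivative_eq_intros simp del: power_Suc fact_Suc)
    moreover have "?B * (real (Suc k) * (M * t) ^ k * M) / fact (Suc k) = M * (?B * (M * t) ^ k / fact k)"
    proof -
      have "b * (s * p * M) / (s * f) = M * (b * p / f)" if "s \<noteq> 0" for b s p f :: real
        using that by simp
      then show ?thesis
        by (simp only: fact_Suc of_nat_mult of_nat_neq_0 not_False_eq_True)
    qed
    ultimately show ?thesis by (simp only: has_real_derivative_iff_has_vector_derivative)
  qed
  then have "norm (picard_term K (Suc k) x - picard_term K (Suc k) 0)
      \<le> ?B * (M * x) ^ Suc k / fact (Suc k) - ?B * (M * 0) ^ Suc k / fact (Suc k)"
  proof (intro norm_diff_le_by_derivative[where f' = "\<lambda>t. K t ** picard_term K k t"
        and \<phi>' = "\<lambda>t. M * (?B * (M * t) ^ k / fact k)"])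
    fix t assume t: "0 < t" "t < x"
    show "norm (K t ** picard_term K k t) \<le> M * (?B * (M * t) ^ k / fact k)"
      using t Suc.prems by (intro order_trans[OF M] mult_left_mono Suc.IH \<open>0 \<le> M\<close>) auto
  qed (use Suc.prems picard_term_derivative[OF K] in \<open>auto simp del: power_Suc fact_Suc\<close>)
  then show ?case by (simp add: picard_term.simps(2))
qed simp

text \<open>The iterated integrals add up to a power series in \<open>z\<close>.  By the factorials in their bounds it
  converges uniformly on compact sets of \<open>(x, z)\<close>, which yields both the differential equation and
  continuity in \<open>z\<close>; the latter carries inequalities over to exceptional values of \<open>z\<close>.\<close>
theorem linear_system_fundamental_solution:
  fixes K :: "real \<Rightarrow> complex ^ 'n ^ 'n"
  assumes K: "continuous_on {0..} K"
  obtains W where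
    "\<And>z x. 0 \<le> x \<Longrightarrow> (W z has_vector_derivative z *c (K x ** W z x)) (at x within {0..})"
    and "\<And>z. W z 0 = mat 1"
    and "\<And>x. 0 \<le> x \<Longrightarrow> continuous_on UNIV (\<lambda>z. W z x)"
proof -
  let ?P = "picard_term K" and ?B = "norm (mat 1 :: complex ^ 'n ^ 'n)"
  define W where "W z x = (\<Sum>k. z ^ k *c ?P k x)" for z x
  have bound: "\<exists>M\<ge>0. \<forall>t\<in>{0..R}. \<forall>Y :: complex ^ 'n ^ 'n. norm (K t ** Y) \<le> M * norm Y" for R
  proof -
    have "continuous_on {0..R} K"
      by (rule continuous_on_subset[OF K]) auto
    then have "bounded (K ` {0..R})"
      by (intro compact_imp_bounded compact_continuous_image) auto
    then obtain D where D: "0 < D" "\<And>t. t \<in> {0..R} \<Longrightarrow> norm (K t) \<le> D"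
      by (auto simp: bounded_pos)
    have "norm (K t ** Y) \<le> D * norm Y" if "t \<in> {0..R}" for t and Y :: "complex ^ 'n ^ 'n"
      by (rule order_trans[OF norm_matrix_mult_le]) (use D(2)[OF that] in \<open>simp add: mult_right_mono\<close>)
    then show ?thesis using D(1) by (intro exI[of _ D]) auto
  qed
  have terms: "\<exists>m. summable m \<and> (\<forall>k. \<forall>x\<in>{0..R}. \<forall>z\<in>cball 0 r. norm (z ^ k *c ?P k x) \<le> m k)" for R r
  proof -
    obtain M where M: "M \<ge> 0" "\<And>t (Y :: complex ^ 'n ^ 'n). t \<in> {0..R} \<Longrightarrow> norm (K t ** Y) \<le> M * norm Y"
      using bound by blast
    have "summable (\<lambda>k. ?B * ((r * (M * R)) ^ k /\<^sub>R fact k))"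
      by (intro summable_mult summable_exp_generic)
    moreover have "norm (z ^ k *c ?P k x) \<le> ?B * ((r * (M * R)) ^ k /\<^sub>R fact k)"
      if "x \<in> {0..R}" "z \<in> cball 0 r" for k x z
    proof -
      have "norm (z ^ k *c ?P k x) = cmod z ^ k * norm (?P k x)"
        by (simp add: norm_cscale norm_power)
      also have "\<dots> \<le> r ^ k * (?B * (M * x) ^ k / fact k)"
        using that order_trans[OF norm_ge_zero, of z r] by (intro mult_mono power_mono picard_term_bound[OF K M]) auto
      also have "\<dots> \<le> r ^ k * (?B * (M * R) ^ k / fact k)"
        using that M(1) order_trans[OF norm_ge_zero, of z r]
        by (intro mult_left_mono divide_right_mono power_mono) auto
      finally show ?thesis by (simp add: power_mult_distrib divide_inverse mult_ac)
    qed
    ultimately show ?thesis by blast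
  qed
  have sums: "(\<lambda>k. z ^ k *c ?P k x) sums W z x" if "0 \<le> x" for z x
  proof -
    obtain m where m: "summable m"
        "\<forall>k. \<forall>t\<in>{0..x}. \<forall>w\<in>cball 0 (cmod z). norm (w ^ k *c ?P k t) \<le> m k"
      using terms[of x "cmod z"] by blast
    have "norm (z ^ k *c ?P k x) \<le> m k" for k
      using m(2) that by simp
    then have "summable (\<lambda>k. z ^ k *c ?P k x)"
      by (rule summable_comparison_test'[OF m(1), of 0])
    then show ?thesis unfolding W_def by (rule summable_sums)
  qed
  have "(W z has_vector_derivative z *c (K x ** W z x)) (at x within {0..})" if "0 \<le> x" for z x
  proof -
    define S where "S = {0..x+1}"
    \<comment> \<open>Differentiation shifts the series by one index; the term of index \<open>0\<close> is constant.\<close>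
    define f' where "f' k t = (case k of 0 \<Rightarrow> 0 | Suc l \<Rightarrow> z *c (K t ** (z ^ l *c ?P l t)))" for k t
    have f': "((\<lambda>t. z ^ k *c ?P k t) has_vector_derivative f' k t) (at t within S)" if "t \<in> S" for k t
    proof (cases k)
      case (Suc l)
      have "((\<lambda>t. z ^ k *c ?P k t) has_vector_derivative z ^ k *c (K t ** ?P l t)) (at t within {0..})"
        using picard_term_derivative(1)[OF K, of t l] that
        unfolding Suc S_def by (intro has_vector_derivative_cscale) auto
      then show ?thesis
        unfolding Suc f'_def
        by (auto simp: matrix_mult_linear cscale_linear S_def
            intro: has_vector_derivative_within_subset[of _ _ _ "{0..}"])
    qed (simp add: f'_def)
    obtain m where m0: "summable m"
        "\<forall>k. \<forall>t\<in>{0..x+1}. \<forall>w\<in>cball 0 (cmod z). norm (w ^ k *c ?P k t) \<le> m k"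
      using terms[of "x+1" "cmod z"] by blast
    have m: "norm (z ^ k *c ?P k t) \<le> m k" if "t \<in> S" for k t
      using m0(2) that by (simp add: S_def)
    obtain M where M: "M \<ge> 0" "\<And>t (Y :: complex ^ 'n ^ 'n). t \<in> S \<Longrightarrow> norm (K t ** Y) \<le> M * norm Y"
      using bound[of "x+1"] unfolding S_def by blast
    have f'_sums: "(\<lambda>k. f' k t) sums (z *c (K t ** W z t))" if "t \<in> S" for t
    proof -
      have "(\<lambda>l. z *c (K t ** (z ^ l *c ?P l t))) sums (z *c (K t ** W z t))"
        using that by (intro bounded_linear.sums[OF bounded_linear_cscale] sums
            bounded_linear.sums[OF bounded_bilinear.bounded_linear_right[OF bounded_bilinear_matrix_mult]])
          (auto simp: S_def)
      then show ?thesis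
        using sums_Suc_iff[of "\<lambda>k. f' k t" "z *c (K t ** W z t)"] by (simp add: f'_def)
    qed
    define m' where "m' k = (case k of 0 \<Rightarrow> 0 | Suc l \<Rightarrow> cmod z * (M * m l))" for k
    have "summable m'"
      by (subst summable_Suc_iff[symmetric]) (simp add: m'_def m0(1) summable_mult)
    moreover have "norm (f' k t) \<le> m' k" if "t \<in> S" for k t
    proof (cases k)
      case (Suc l)
      have "norm (K t ** (z ^ l *c ?P l t)) \<le> M * m l"
        using M(2)[OF that] mult_left_mono[OF m[OF that, of l] M(1)] by (rule order_trans)
      then show ?thesis by (simp add: Suc f'_def m'_def norm_cscale mult_left_mono)
    qed (simp add: f'_def m'_def)
    ultimately have unif: "uniform_limit S (\<lambda>n t. \<Sum>k<n. f' k t) (\<lambda>t. \<Sum>k. f' k t) sequentially"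
      by (intro Weierstrass_m_test[where M = m'])
    have "\<exists>g. \<forall>t\<in>S. (\<lambda>k. z ^ k *c ?P k t) sums g t \<and>
        (g has_derivative (\<lambda>h. h *\<^sub>R (z *c (K t ** W z t)))) (at t within S)"
    proof (rule has_derivative_series)
      show "convex S" by (simp add: S_def)
      show "((\<lambda>t. z ^ k *c ?P k t) has_derivative (\<lambda>h. h *\<^sub>R f' k t)) (at t within S)"
        if "t \<in> S" for k t
        using f'[OF that] by (simp add: has_vector_derivative_def)
      show "\<forall>\<^sub>F n in sequentially. \<forall>t\<in>S. \<forall>h.
          norm ((\<Sum>k<n. h *\<^sub>R f' k t) - h *\<^sub>R (z *c (K t ** W z t))) \<le> e * norm h" if "e > 0" for e
        using uniform_limitD[OF unif that]
      proof (rule eventually_mono, intro ballI allI)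
        fix n t h assume *: "\<forall>t\<in>S. dist (\<Sum>k<n. f' k t) (\<Sum>k. f' k t) < e" and t: "t \<in> S"
        have "(\<Sum>k<n. h *\<^sub>R f' k t) - h *\<^sub>R (z *c (K t ** W z t)) = h *\<^sub>R ((\<Sum>k<n. f' k t) - (\<Sum>k. f' k t))"
          using sums_unique[OF f'_sums[OF t]] by (simp add: scaleR_sum_right scaleR_diff_right)
        moreover have "norm ((\<Sum>k<n. f' k t) - (\<Sum>k. f' k t)) \<le> e"
          using * t by (auto simp: dist_norm)
        ultimately show "norm ((\<Sum>k<n. h *\<^sub>R f' k t) - h *\<^sub>R (z *c (K t ** W z t))) \<le> e * norm h"
          by (simp add: mult_left_mono mult.commute[of e])
      qed
      show "0 \<in> S" using \<open>0 \<le> x\<close> by (simp add: S_def)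
      show "(\<lambda>k. z ^ k *c ?P k 0) sums W z 0" by (rule sums) simp
    qed
    then obtain g where g: "\<And>t. t \<in> S \<Longrightarrow> (\<lambda>k. z ^ k *c ?P k t) sums g t"
        "\<And>t. t \<in> S \<Longrightarrow> (g has_vector_derivative z *c (K t ** W z t)) (at t within S)"
      unfolding has_vector_derivative_def by blast
    have "g t = W z t" if "t \<in> S" for t
      using sums_unique2[OF g(1)[OF that] sums[of t z]] that by (simp add: S_def)
    moreover have "x \<in> S" using \<open>0 \<le> x\<close> by (simp add: S_def)
    ultimately have "(W z has_vector_derivative z *c (K x ** W z x)) (at x within S)"
      using g(2) has_vector_derivative_transform[of x S "W z" g] by auto
    then show ?thesis
      using \<open>0 \<le> x\<close> by (simp add: at_within_half_line[of x "x+1"] S_def)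
  qed
  moreover have "W z 0 = mat 1" for z
  proof -
    have "z ^ k *c ?P k 0 = 0" if "k \<notin> {0}" for k
      using that by (cases k) (auto simp: cscale_linear picard_term.simps(2))
    then have "(\<lambda>k. z ^ k *c ?P k 0) sums (\<Sum>k\<in>{0}. z ^ k *c ?P k 0)"
      by (intro sums_finite) auto
    then have "(\<lambda>k. z ^ k *c ?P k 0) sums mat 1"
      by (simp add: cscale_linear)
    then show ?thesis using sums_unique2[OF sums[of 0 z]] by simp
  qed
  moreover have "continuous_on UNIV (\<lambda>z. W z x)" if "0 \<le> x" for x
  proof -
    have "continuous_on (ball 0 r) (\<lambda>z. W z x)" for r
    proof -
      obtain m where m0: "summable m"
          "\<forall>k. \<forall>t\<in>{0..x}. \<forall>w\<in>cball 0 r. norm (w ^ k *c ?P k t) \<le> m k"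
        using terms[of x r] by blast
      have m: "norm (z ^ k *c ?P k x) \<le> m k" if "z \<in> ball 0 r" for k z
        using m0(2) that \<open>0 \<le> x\<close> by simp
      have "uniform_limit (ball 0 r) (\<lambda>n z. \<Sum>k<n. z ^ k *c ?P k x) (\<lambda>z. W z x) sequentially"
        unfolding W_def using m m0(1) by (rule Weierstrass_m_test)
      then show ?thesis
        by (rule uniform_limit_theorem[rotated])
          (auto intro!: always_eventually continuous_intros)
    qed
    then have "continuous_on (\<Union>r. ball 0 r) (\<lambda>z. W z x)"
      by (intro continuous_on_open_UN) auto
    moreover have "(\<Union>r. ball (0 :: complex) r) = UNIV"
      by (auto intro: gt_ex)
    ultimately show ?thesis by simp
  qed
  ultimately show ?thesis by (rule that)
qed

section \<open>Canonical systems\<close>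

text \<open>Unlike a fundamental solution, \<open>Y\<close> may have any number of columns and any initial value.\<close>
definition canonical_solution ::
  "(real \<Rightarrow> complex ^ ('p + 'p) ^ ('p::finite + 'p)) \<Rightarrow> complex \<Rightarrow>
   (real \<Rightarrow> complex ^ 'k ^ ('p + 'p)) \<Rightarrow> bool"
  where "canonical_solution H z Y \<longleftrightarrow>
    (\<forall>x\<ge>0. (Y has_vector_derivative (\<i> * z) *c (jmat ** H x ** Y x)) (at x within {0..}))"

lemma fundamental_solution_iff:
  "fundamental_solution H z W \<longleftrightarrow> W 0 = mat 1 \<and> canonical_solution H z W"
  by (simp add: fundamental_solution_def canonical_solution_def)

lemma canonical_solutionD:
  "canonical_solution H z Y \<Longrightarrow> 0 \<le> x \<Longrightarrow>
    (Y has_vector_derivative (\<i> * z) *c (jmat ** H x ** Y x)) (at x within {0..})"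
  by (simp add: canonical_solution_def)

lemma canonical_solution_mult:
  assumes "canonical_solution H z Y"
  shows "canonical_solution H z (\<lambda>x. Y x ** B)"
  unfolding canonical_solution_def
proof (intro allI impI)
  fix x :: real assume "0 \<le> x"
  then show "((\<lambda>x. Y x ** B) has_vector_derivative (\<i> * z) *c (jmat ** H x ** (Y x ** B)))
      (at x within {0..})"
    using has_vector_derivative_matrix_mult_const_right[OF canonical_solutionD[OF assms], of x B]
    by (simp add: matrix_mult_linear matrix_mul_assoc)
qed

lemma ctranspose_hamiltonian: "ctranspose (hamiltonian b x) = hamiltonian b x"
  by (simp add: hamiltonian_def ctranspose_simps)

lemma canonical_solution_continuous:
  "canonical_solution H z Y \<Longrightarrow> continuous_on {0..} Y"
  by (rule has_vector_derivative_continuous_on) (auto intro: canonical_solutionD)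

lemma fundamental_solution_exists:
  fixes b :: "real \<Rightarrow> complex ^ ('p::finite + 'p) ^ 'p"
  assumes b: "continuous_on {0..} b"
  obtains W where "\<And>z. fundamental_solution (hamiltonian b) z (W z)"
    and "\<And>x. 0 \<le> x \<Longrightarrow> continuous_on UNIV (\<lambda>z. W z x)"
proof -
  have "continuous_on {0..} (\<lambda>x. jmat ** hamiltonian b x)"
    unfolding hamiltonian_def by (intro continuous_intros b)
  then obtain V where V:
    "\<And>z x. 0 \<le> x \<Longrightarrow> (V z has_vector_derivative z *c (jmat ** hamiltonian b x ** V z x)) (at x within {0..})"
    "\<And>z. V z 0 = mat 1"
    "\<And>x. 0 \<le> x \<Longrightarrow> continuous_on UNIV (\<lambda>z. V z x)"
    by (rule linear_system_fundamental_solution) blast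
  show ?thesis
  proof (rule that[of "\<lambda>z. V (\<i> * z)"])
    show "fundamental_solution (hamiltonian b) z (V (\<i> * z))" for z
      using V(1,2) by (simp add: fundamental_solution_def)
    show "continuous_on UNIV (\<lambda>z. V (\<i> * z) x)" if "0 \<le> x" for x
      by (rule continuous_on_compose2[OF V(3)[OF that]]) (auto intro!: continuous_intros)
  qed
qed

text \<open>The derivatives of the two factors cancel because \<open>H\<close> is Hermitian and \<open>j j = 1\<close>.\<close>
lemma canonical_wronskian_constant:
  assumes H: "\<And>x. ctranspose (H x) = H x"
    and X: "canonical_solution H (cnj z) X" and Y: "canonical_solution H z Y" and "0 \<le> x"
  shows "ctranspose (X x) ** (jmat ** Y x) = ctranspose (X 0) ** (jmat ** Y 0)"
proof (rule constant_by_derivative[where f = "\<lambda>x. ctranspose (X x) ** (jmat ** Y x)"])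
  fix x :: real assume "0 \<le> x"
  show "((\<lambda>x. ctranspose (X x) ** (jmat ** Y x)) has_vector_derivative 0) (at x within {0..})"
    by (rule has_vector_derivative_eq_rhs, rule has_vector_derivative_matrix_mult,
        rule has_vector_derivative_ctranspose, rule canonical_solutionD[OF X \<open>0 \<le> x\<close>],
        rule has_vector_derivative_matrix_mult_const_left, rule canonical_solutionD[OF Y \<open>0 \<le> x\<close>])
      (simp add: ctranspose_simps H ctranspose_jmat matrix_mult_linear cscale_linear
        matrix_mul_assoc[symmetric] jmat_jmat)
qed fact

text \<open>With \<open>V\<close> the fundamental solution at \<open>cnj z\<close>, the Wronskian identity shows that \<open>V(x)\<^sup>* j\<close> maps
  both \<open>Y(x)\<close> and \<open>W(x) Y(0)\<close> to \<open>j Y(0)\<close>; applied to \<open>W\<close> itself it shows that \<open>V(x)\<^sup>* j\<close> is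
  invertible.\<close>
lemma canonical_solution_unique:
  assumes b: "continuous_on {0..} b" and W: "fundamental_solution (hamiltonian b) z W"
    and Y: "canonical_solution (hamiltonian b) z Y" and "0 \<le> x"
  shows "Y x = W x ** Y 0"
proof -
  obtain V where "fundamental_solution (hamiltonian b) (cnj z) V"
    by (rule fundamental_solution_exists[OF b]) blast
  then have V: "canonical_solution (hamiltonian b) (cnj z) V" "V 0 = mat 1"
    by (simp_all add: fundamental_solution_iff)
  have *: "ctranspose (V x) ** (jmat ** X x) = jmat ** X 0" if "canonical_solution (hamiltonian b) z X"
    for X :: "real \<Rightarrow> complex ^ 'l ^ ('a + 'a)"
    using canonical_wronskian_constant[OF ctranspose_hamiltonian V(1) that \<open>0 \<le> x\<close>]
    by (simp add: V(2) ctranspose_simps)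
  have "(jmat ** ctranspose (V x) ** jmat) ** W x = mat 1"
    using *[of W] W by (simp add: fundamental_solution_iff jmat_mult_jmat flip: matrix_mul_assoc)
  then have inv: "W x ** (jmat ** ctranspose (V x) ** jmat) = mat 1"
    by (simp add: matrix_left_right_inverse)
  have "W x ** Y 0 = W x ** (jmat ** (ctranspose (V x) ** (jmat ** Y x)))"
    using *[OF Y] by (simp add: jmat_jmat)
  also have "\<dots> = Y x"
    using arg_cong[OF inv, of "\<lambda>M. M ** Y x"] by (simp add: matrix_mul_assoc)
  finally show ?thesis by simp
qed

text \<open>The energy identity: \<open>- J(Y) / (2 Im z)\<close> is a primitive of \<open>|b Y|\<^sup>2\<close>.\<close>
lemma jform_derivative:
  assumes Y: "canonical_solution (hamiltonian b) z Y" and "0 \<le> x"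
  shows "((\<lambda>x. jform (Y x)) has_vector_derivative - (2 * Im z * (norm (b x ** Y x))\<^sup>2)) (at x within {0..})"
proof -
  let ?D = "(\<i> * z) *c (jmat ** hamiltonian b x ** Y x)"
  have "inner (Y x) (jmat ** ?D) = - (Im z * (norm (b x ** Y x))\<^sup>2)"
  proof -
    have "jmat ** ?D = (\<i> * z) *c (ctranspose (b x) ** (b x ** Y x))"
      by (simp add: hamiltonian_def matrix_mult_linear matrix_mul_assoc[symmetric] jmat_jmat)
    also have "\<dots> = ctranspose (b x) ** ((\<i> * z) *c (b x ** Y x))"
      by (simp add: matrix_mult_linear)
    also have "inner (Y x) \<dots> = inner (b x ** Y x) ((\<i> * z) *c (b x ** Y x))"
      by (simp add: inner_mult_left)
    finally show ?thesis by (simp add: inner_cscale_self)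
  qed
  moreover have "inner ?D (jmat ** Y x) = inner (Y x) (jmat ** ?D)"
    by (simp only: inner_commute[of ?D] inner_mult_left ctranspose_jmat)
  ultimately show ?thesis
    unfolding jform_def
    by (intro has_vector_derivative_eq_rhs[OF has_vector_derivative_inner[OF
            canonical_solutionD[OF Y \<open>0 \<le> x\<close>] has_vector_derivative_matrix_mult_const_left[OF
              canonical_solutionD[OF Y \<open>0 \<le> x\<close>]]]]) simp
qed

text \<open>The trace of \<open>B\<^sup>* B\<close> is \<open>|B|\<^sup>2\<close>, which also dominates the norm of \<open>B\<^sup>* B\<close>.\<close>
lemma gram_absolutely_integrable_iff:
  fixes B :: "real \<Rightarrow> complex ^ 'k ^ 'm"
  assumes B: "continuous_on {0..} B"
  shows "(\<lambda>x. ctranspose (B x) ** B x) absolutely_integrable_on {0..} \<longleftrightarrow>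
    (\<lambda>x. (norm (B x))\<^sup>2) integrable_on {0..}"
proof
  assume "(\<lambda>x. ctranspose (B x) ** B x) absolutely_integrable_on {0..}"
  then have "(\<lambda>x. ctranspose (B x) ** B x) integrable_on {0..}"
    by (rule set_lebesgue_integral_eq_integral)
  from integrable_linear[OF this bounded_linear_inner_right[of "mat 1"]]
  show "(\<lambda>x. (norm (B x))\<^sup>2) integrable_on {0..}"
    by (simp add: o_def inner_mult_right ctranspose_ctranspose power2_norm_eq_inner)
next
  assume int: "(\<lambda>x. (norm (B x))\<^sup>2) integrable_on {0..}"
  show "(\<lambda>x. ctranspose (B x) ** B x) absolutely_integrable_on {0..}"
  proof (rule measurable_bounded_by_integrable_imp_absolutely_integrable)
    show "(\<lambda>x. ctranspose (B x) ** B x) \<in> borel_measurable (lebesgue_on {0..})"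
      by (intro continuous_imp_measurable_on_sets_lebesgue continuous_intros B) simp
    show "(\<lambda>x. (norm (B x))\<^sup>2) integrable_on {0..}" by (rule int)
    show "norm (ctranspose (B x) ** B x) \<le> (norm (B x))\<^sup>2" for x
      using norm_matrix_mult_le[of "ctranspose (B x)" "B x"]
      by (simp add: norm_ctranspose power2_eq_square)
  qed auto
qed

lemma weyl_integrand_integrable_iff:
  assumes b: "continuous_on {0..} b" and W: "fundamental_solution (hamiltonian b) z W"
  shows "(\<lambda>x. hstack (mat 1) (ctranspose F) ** ctranspose (W x) ** hamiltonian b x ** W x
      ** vstack (mat 1) F) absolutely_integrable_on {0..} \<longleftrightarrow>
    (\<lambda>x. (norm (b x ** (W x ** vstack (mat 1) F)))\<^sup>2) integrable_on {0..}"
proof -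
  have "continuous_on {0..} W"
    using W by (auto simp: fundamental_solution_iff intro: canonical_solution_continuous)
  then have "continuous_on {0..} (\<lambda>x. b x ** (W x ** vstack (mat 1) F))"
    by (intro continuous_intros b)
  from gram_absolutely_integrable_iff[OF this] show ?thesis
    by (simp add: hamiltonian_def ctranspose_simps ctranspose_vstack matrix_mul_assoc)
qed

lemma norm_integrable_if_jform_nonneg:
  assumes Y: "canonical_solution (hamiltonian b) z Y" and z: "0 < Im z"
    and nonneg: "\<And>x. 0 \<le> x \<Longrightarrow> 0 \<le> jform (Y x)"
  shows "(\<lambda>x. (norm (b x ** Y x))\<^sup>2) integrable_on {0..}"
proof (rule integrable_if_primitive_bounded[where G = "\<lambda>x. (- 1 / (2 * Im z)) *\<^sub>R jform (Y x)" and C = 0])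
  show "((\<lambda>x. (- 1 / (2 * Im z)) *\<^sub>R jform (Y x)) has_vector_derivative (norm (b x ** Y x))\<^sup>2) (at x within {0..})"
    if "0 \<le> x" for x
    by (rule has_vector_derivative_eq_rhs[OF bounded_linear.has_vector_derivative[OF
            bounded_linear_scaleR_right jform_derivative[OF Y that]]])
      (use z in \<open>simp add: field_simps\<close>)
qed (use z nonneg in \<open>auto intro: divide_nonneg_pos\<close>)

section \<open>The Darboux transformation\<close>

text \<open>Column by column, the trace form of a positive definite matrix is its ordinary quadratic form.\<close>
lemma inner_pos_def:
  fixes M :: "complex ^ 'n ^ 'n" and Q :: "complex ^ 'k ^ 'n"
  assumes "pos_def M" and "Q \<noteq> 0"
  shows "0 < inner Q (M ** Q)"
proof -
  let ?f = "\<lambda>k. Re (\<Sum>i\<in>UNIV. cnj (column k Q $ i) * (M *v column k Q) $ i)"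
  have eq: "inner Q (M ** Q) = (\<Sum>k\<in>UNIV. ?f k)"
    by (simp add: inner_matrix column_def matrix_vector_mult_def matrix_matrix_mult_def
        sum.swap[of _ "UNIV :: 'k set"])
  have pos: "column k Q \<noteq> 0 \<Longrightarrow> 0 < ?f k" for k
    using assms(1) by (simp add: pos_def_def)
  have "0 \<le> ?f k" for k
    using pos[of k] by (cases "column k Q = 0") auto
  moreover obtain k where "column k Q \<noteq> 0"
    using assms(2) by (auto simp: vec_eq_iff column_def)
  ultimately show ?thesis
    unfolding eq using pos by (intro sum_pos2[of _ k]) auto
qed

text \<open>The data of the transformation, for an arbitrary Hamiltonian of the form \<open>b\<^sup>* b\<close> with \<open>b\<close> continuous.\<close>
locale darboux =
  fixes A :: "complex ^ 'n ^ 'n"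
    and b :: "real \<Rightarrow> complex ^ ('p::finite + 'p) ^ 'p"
    and \<Lambda> :: "real \<Rightarrow> complex ^ ('p + 'p) ^ 'n"
    and S :: "real \<Rightarrow> complex ^ 'n ^ 'n"
  assumes continuous_b: "continuous_on {0..} b"
    and invertible_A: "invertible A"
    and pos_def_S0: "pos_def (S 0)"
    and identity_0: "A ** S 0 - S 0 ** ctranspose A = \<i> *c (\<Lambda> 0 ** jmat ** ctranspose (\<Lambda> 0))"
    and \<Lambda>_derivative: "\<And>x. 0 \<le> x \<Longrightarrow>
      (\<Lambda> has_vector_derivative (- \<i>) *c (A ** \<Lambda> x ** jmat ** hamiltonian b x)) (at x within {0..})"
    and S_derivative: "\<And>x. 0 \<le> x \<Longrightarrow>
      (S has_vector_derivative \<Lambda> x ** jmat ** hamiltonian b x ** jmat ** ctranspose (\<Lambda> x))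
        (at x within {0..})"
begin

abbreviation "H \<equiv> hamiltonian b"
abbreviation "w \<equiv> w\<^sub>A A \<Lambda> S"

text \<open>\<open>N\<close>, \<open>T\<close> and the resolvent \<open>R\<close> are the factors of
  \<open>w\<^sub>A = 1 - \<i> N T R \<Lambda>\<close>.\<close>
definition N :: "real \<Rightarrow> complex ^ 'n ^ ('p + 'p)"
  where "N x = jmat ** ctranspose (\<Lambda> x)"

definition T :: "real \<Rightarrow> complex ^ 'n ^ 'n"
  where "T x = matrix_inv (S x)"

definition R :: "complex \<Rightarrow> complex ^ 'n ^ 'n"
  where "R z = matrix_inv (A - mat z)"

lemma jmat_N: "jmat ** (N x ** Y) = ctranspose (\<Lambda> x) ** Y"
  by (simp add: N_def jmat_jmat flip: matrix_mul_assoc)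

lemma ctranspose_N: "ctranspose (N x) = \<Lambda> x ** jmat"
  by (simp add: N_def ctranspose_simps ctranspose_jmat)

lemma N_derivative: "0 \<le> x \<Longrightarrow>
    (N has_vector_derivative \<i> *c (jmat ** (H x ** (N x ** ctranspose A)))) (at x within {0..})"
  unfolding N_def
  by (rule has_vector_derivative_eq_rhs, rule has_vector_derivative_matrix_mult_const_left,
      rule has_vector_derivative_ctranspose, rule \<Lambda>_derivative, assumption)
    (simp add: ctranspose_simps ctranspose_hamiltonian ctranspose_jmat matrix_mult_linear
      flip: matrix_mul_assoc)

lemma S_derivative': "0 \<le> x \<Longrightarrow>
    (S has_vector_derivative \<Lambda> x ** (jmat ** (H x ** N x))) (at x within {0..})"
  using S_derivative[of x] by (simp add: N_def flip: matrix_mul_assoc)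

lemma \<Lambda>_derivative': "0 \<le> x \<Longrightarrow>
    (\<Lambda> has_vector_derivative (- \<i>) *c (A ** (\<Lambda> x ** (jmat ** H x)))) (at x within {0..})"
  using \<Lambda>_derivative[of x] by (simp flip: matrix_mul_assoc)

lemma S_hermitian:
  assumes "0 \<le> x" shows "ctranspose (S x) = S x"
proof -
  have "ctranspose (S x) - S x = ctranspose (S 0) - S 0"
  proof (rule constant_by_derivative[where f = "\<lambda>x. ctranspose (S x) - S x"])
    fix x :: real assume "0 \<le> x"
    show "((\<lambda>x. ctranspose (S x) - S x) has_vector_derivative 0) (at x within {0..})"
      by (rule has_vector_derivative_eq_rhs, rule has_vector_derivative_diff,
          rule has_vector_derivative_ctranspose, (rule S_derivative'[OF \<open>0 \<le> x\<close>])+)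
        (simp add: N_def ctranspose_simps ctranspose_jmat ctranspose_hamiltonian
          flip: matrix_mul_assoc)
  qed fact
  then show ?thesis using pos_def_S0 by (simp add: pos_def_def)
qed

text \<open>Both sides have the same derivative, by the differential equations for \<open>\<Lambda>\<close> and \<open>S\<close>.\<close>
lemma identity:
  assumes "0 \<le> x"
  shows "A ** S x - S x ** ctranspose A = \<i> *c (\<Lambda> x ** N x)"
proof -
  let ?f = "\<lambda>x. A ** S x - S x ** ctranspose A - \<i> *c (\<Lambda> x ** N x)"
  have "?f x = ?f 0"
  proof (rule constant_by_derivative)
    fix x :: real assume x: "0 \<le> x"
    show "(?f has_vector_derivative 0) (at x within {0..})"
      by (rule has_vector_derivative_eq_rhs, (rule has_vector_derivative_diff
            has_vector_derivative_cscale
            has_vector_derivative_matrix_mult_const_left[OF S_derivative'[OF x]]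
            has_vector_derivative_matrix_mult_const_right[OF S_derivative'[OF x]]
            has_vector_derivative_matrix_mult
            \<Lambda>_derivative'[OF x] N_derivative[OF x])+)
        (simp add: matrix_mult_linear cscale_linear flip: matrix_mul_assoc)
  qed fact
  moreover have "?f 0 = 0"
    unfolding N_def matrix_mul_assoc identity_0 by simp
  ultimately show ?thesis by (simp only: right_minus_eq)
qed

text \<open>\<open>S\<close> increases because \<open>S' = (b j \<Lambda>\<^sup>*)\<^sup>* (b j \<Lambda>\<^sup>*)\<close>, so it stays positive definite.\<close>
lemma S_positive:
  fixes Q :: "complex ^ 'k ^ 'n"
  assumes "0 \<le> x" and "Q \<noteq> 0"
  shows "0 < inner Q (S x ** Q)"
proof -
  have "inner Q (S 0 ** Q) \<le> inner Q (S x ** Q)"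
  proof (rule nondecreasing_by_derivative[where \<phi>' = "\<lambda>x. (norm (b x ** (N x ** Q)))\<^sup>2"])
    fix x :: real assume "0 \<le> x"
    have "\<Lambda> x ** (jmat ** (H x ** N x)) ** Q = ctranspose (b x ** N x) ** (b x ** (N x ** Q))"
      by (simp add: hamiltonian_def ctranspose_mult ctranspose_N flip: matrix_mul_assoc)
    then have "inner Q (\<Lambda> x ** (jmat ** (H x ** N x)) ** Q) = (norm (b x ** (N x ** Q)))\<^sup>2"
      by (simp add: power2_norm_eq_inner inner_mult_right ctranspose_ctranspose flip: matrix_mul_assoc)
    then show "((\<lambda>x. inner Q (S x ** Q)) has_vector_derivative (norm (b x ** (N x ** Q)))\<^sup>2)
        (at x within {0..})"
      using bounded_linear.has_vector_derivative[OF bounded_linear_inner_right[of Q]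
          has_vector_derivative_matrix_mult_const_right[OF S_derivative'[OF \<open>0 \<le> x\<close>], of Q]]
      by simp
  qed (use assms in auto)
  then show ?thesis using inner_pos_def[OF pos_def_S0 assms(2)] by simp
qed

lemma S_nonneg: "0 \<le> x \<Longrightarrow> 0 \<le> inner Q (S x ** Q)"
  using S_positive[of x Q] by (cases "Q = 0") (auto simp: matrix_mult_linear)

lemma invertible_S: "0 \<le> x \<Longrightarrow> invertible (S x)"
  using S_positive[of x] by (intro invertible_if_injective) force

lemma S_T: "0 \<le> x \<Longrightarrow> S x ** (T x ** Y) = Y" and T_S: "0 \<le> x \<Longrightarrow> T x ** (S x ** Y) = Y"
  by (simp_all add: T_def matrix_inv_right_cancel matrix_inv_left_cancel invertible_S)

lemma T_hermitian: "0 \<le> x \<Longrightarrow> ctranspose (T x) = T x"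
  by (simp add: T_def ctranspose_matrix_inv invertible_S S_hermitian)

lemma T_derivative:
  assumes "0 \<le> x"
  shows "(T has_vector_derivative - (T x ** (\<Lambda> x ** (jmat ** (H x ** (N x ** T x)))))) (at x within {0..})"
  unfolding T_def
  by (rule has_vector_derivative_eq_rhs[OF has_vector_derivative_matrix_inv[OF S_derivative'[OF assms]]])
    (use assms in \<open>auto intro!: invertible_S has_vector_derivative_continuous_on S_derivative'
      simp flip: matrix_mul_assoc\<close>)

lemma T_identity:
  assumes "0 \<le> x"
  shows "ctranspose A ** (T x ** Y) = T x ** (A ** Y) - \<i> *c (T x ** (\<Lambda> x ** (N x ** (T x ** Y))))"
proof -
  have "S x ** ctranspose A = A ** S x - \<i> *c (\<Lambda> x ** N x)"
    using identity[OF assms] by (simp add: algebra_simps)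
  then have "T x ** ((S x ** ctranspose A) ** (T x ** Y))
      = T x ** ((A ** S x - \<i> *c (\<Lambda> x ** N x)) ** (T x ** Y))"
    by simp
  then show ?thesis
    by (simp add: matrix_mult_linear S_T T_S assms flip: matrix_mul_assoc)
qed

lemma R_A: "invertible (A - mat z) \<Longrightarrow> R z ** (A ** Y) = Y + z *c (R z ** Y)"
  and A_R: "invertible (A - mat z) \<Longrightarrow> A ** (R z ** Y) = Y + z *c (R z ** Y)"
  using matrix_inv_left_cancel[of "A - mat z" Y] matrix_inv_right_cancel[of "A - mat z" Y]
  by (simp_all add: R_def matrix_mult_linear matrix_mult_mat_left algebra_simps)

lemma w_mult: "w x z ** Y = Y - \<i> *c (N x ** (T x ** (R z ** (\<Lambda> x ** Y))))"
  by (simp add: w\<^sub>A_def N_def T_def R_def matrix_mult_linear flip: matrix_mul_assoc)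

text \<open>The identity \<open>w(\<mu>)\<^sup>* j w(z) = j + \<i> (cnj \<mu> - z) \<Lambda>\<^sup>* R(\<mu>)\<^sup>* T R(z) \<Lambda>\<close>, in bilinear form.  It is used three times:
  for \<open>\<mu> = z\<close> it gives monotonicity of \<open>J\<close>, for \<open>\<mu> = cnj z\<close> it gives the inverse of \<open>w\<close>, and for
  \<open>\<mu> = z = 0\<close> it says that \<open>w(0)\<close> preserves \<open>J\<close>.  The proof expands the product and replaces
  \<open>\<Lambda> N\<close> by \<open>- \<i> (A S - S A\<^sup>*)\<close>.\<close>
lemma w_inner:
  fixes X Y :: "complex ^ 'k ^ ('p + 'p)"
  assumes x: "0 \<le> x" and \<mu>: "invertible (A - mat \<mu>)" and z: "invertible (A - mat z)"
  shows "inner (w x \<mu> ** X) (jmat ** (w x z ** Y)) = inner X (jmat ** Y) +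
    inner ((\<i> * (cnj z - \<mu>)) *c (R \<mu> ** (\<Lambda> x ** X))) (T x ** (R z ** (\<Lambda> x ** Y)))"
proof -
  define mX where "mX = R \<mu> ** (\<Lambda> x ** X)"
  define mY where "mY = R z ** (\<Lambda> x ** Y)"
  define qX where "qX = T x ** mX"
  define qY where "qY = T x ** mY"
  have SX: "S x ** qX = mX" and SY: "S x ** qY = mY"
    by (simp_all add: qX_def qY_def S_T x)
  have AX: "A ** mX = \<Lambda> x ** X + \<mu> *c mX" and AY: "A ** mY = \<Lambda> x ** Y + z *c mY"
    by (simp_all add: mX_def mY_def A_R \<mu> z)
  have S_swap: "inner (S x ** U) V = inner U (S x ** V)" for U V :: "complex ^ 'k ^ 'n"
    by (simp add: inner_mult_left S_hermitian x)
  have "\<Lambda> x ** N x = (- \<i>) *c (A ** S x - S x ** ctranspose A)"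
    unfolding identity[OF x] by (simp add: cscale_linear)
  then have \<Lambda>N: "\<Lambda> x ** (N x ** qX) = (- \<i>) *c (A ** mX) + \<i> *c (S x ** (ctranspose A ** qX))"
    by (simp add: matrix_mult_linear cscale_linear SX flip: matrix_mul_assoc)
       (metis (no_types, lifting) SX cscale_diff(1) cscale_minus(2) matrix_mul_assoc
         matrix_mult_cscale_left matrix_mult_diff_left minus_diff_eq)
  have "inner (w x \<mu> ** X) (jmat ** (w x z ** Y)) = inner X (jmat ** Y)
      - inner X (jmat ** (\<i> *c (N x ** qY))) - inner (\<i> *c (N x ** qX)) (jmat ** Y)
      + inner (\<i> *c (N x ** qX)) (jmat ** (\<i> *c (N x ** qY)))"
    by (simp add: w_mult qX_def qY_def mX_def mY_def matrix_mult_diff_right inner_diff_left inner_diff_right)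
  also have "inner X (jmat ** (\<i> *c (N x ** qY))) = inner ((- \<i>) *c (\<Lambda> x ** X)) qY"
    by (simp add: matrix_mult_cscale_right jmat_N inner_cscale_left inner_mult_left)
  also have "inner (\<i> *c (N x ** qX)) (jmat ** Y) = inner (\<i> *c qX) (\<Lambda> x ** Y)"
    by (simp add: inner_cscale_left inner_mult_left N_def ctranspose_simps matrix_mult_linear
        ctranspose_jmat jmat_jmat flip: matrix_mul_assoc)
  also have "inner (\<i> *c (N x ** qX)) (jmat ** (\<i> *c (N x ** qY))) = inner (\<Lambda> x ** (N x ** qX)) qY"
    by (simp add: matrix_mult_cscale_right jmat_N inner_cscale_left cscale_linear inner_mult_left)
  also have "\<dots> = inner ((- \<i>) *c (A ** mX)) qY + inner (\<i> *c qX) (A ** mY)"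
  proof -
    have "inner (\<i> *c (S x ** (ctranspose A ** qX))) qY = inner (S x ** (ctranspose A ** (\<i> *c qX))) qY"
      by (simp add: matrix_mult_linear)
    also have "\<dots> = inner (\<i> *c qX) (A ** mY)"
      by (simp add: S_swap SY inner_mult_left ctranspose_simps S_hermitian x)
    finally show ?thesis by (simp add: \<Lambda>N inner_add_left)
  qed
  also have "inner (\<i> *c qX) (A ** mY) = inner (\<i> *c qX) (\<Lambda> x ** Y) + inner ((\<i> * cnj z) *c mX) qY"
  proof -
    have "inner (\<i> *c qX) (z *c mY) = inner ((\<i> * cnj z) *c qX) (S x ** qY)"
      by (simp add: inner_cscale_left cscale_linear SY mult_ac)
    also have "\<dots> = inner ((\<i> * cnj z) *c mX) qY"
      by (simp add: S_swap[symmetric] matrix_mult_linear SX)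
    finally show ?thesis by (simp add: AY inner_add_right)
  qed
  also have "inner ((- \<i>) *c (A ** mX)) qY
      = inner ((- \<i>) *c (\<Lambda> x ** X)) qY - inner ((\<i> * \<mu>) *c mX) qY"
    by (simp add: AX cscale_linear inner_add_left inner_diff_left)
  finally show ?thesis
    by (simp add: mX_def[symmetric] mY_def[symmetric] qY_def[symmetric] right_diff_distrib
        cscale_diff inner_diff_left)
qed

text \<open>The correction term of \<open>w_inner\<close> at \<open>\<mu> = z\<close> is \<open>2 Im z\<close> times the positive semidefinite form
  \<open>m\<^sup>* S\<^sup>-\<^sup>1 m\<close> with \<open>m = R(z) \<Lambda> Y\<close>.\<close>
lemma jform_w_mono:
  assumes "0 \<le> x" and z: "invertible (A - mat z)" "0 \<le> Im z"
  shows "jform Y \<le> jform (w x z ** Y)"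
proof -
  let ?m = "R z ** (\<Lambda> x ** Y)"
  have eq: "\<i> * (cnj z - z) = of_real (2 * Im z)"
    by (simp add: complex_eq_iff)
  have "inner (T x ** ?m) (S x ** (T x ** ?m)) = inner ?m (T x ** ?m)"
    by (simp add: S_T assms inner_commute)
  then have "0 \<le> inner ((\<i> * (cnj z - z)) *c ?m) (T x ** ?m)"
    using S_nonneg[OF assms(1), of "T x ** ?m"] z(2) unfolding eq
    by (simp add: scaleR_eq_cscale[symmetric] del: of_real_mult)
  then show ?thesis
    using w_inner[OF assms(1) z(1) z(1), of Y Y] by (simp add: jform_def)
qed

lemma w_left_inverse:
  assumes "0 \<le> x" and "invertible (A - mat z)" and "invertible (A - mat (cnj z))"
  shows "(jmat ** ctranspose (w x (cnj z)) ** jmat) ** w x z = mat 1"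
proof -
  have "ctranspose (w x (cnj z)) ** (jmat ** (w x z ** mat 1)) = jmat ** (mat 1 :: complex ^ ('p + 'p) ^ ('p + 'p))"
  proof (rule eq_if_inner_eq)
    fix X :: "complex ^ ('p + 'p) ^ ('p + 'p)"
    show "inner X (ctranspose (w x (cnj z)) ** (jmat ** (w x z ** mat 1))) = inner X (jmat ** mat 1)"
      using w_inner[OF assms(1,3,2), of X "mat 1"]
      by (simp only: inner_mult_left complex_cnj_cnj diff_self mult_zero_right cscale_zero
          inner_zero_left add_0_right)
  qed
  then show ?thesis
    by (simp add: jmat_mult_jmat flip: matrix_mul_assoc)
qed

lemma invertible_w:
  "0 \<le> x \<Longrightarrow> invertible (A - mat z) \<Longrightarrow> invertible (A - mat (cnj z)) \<Longrightarrow> invertible (w x z)"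
  using w_left_inverse by (rule invertible_left)

lemma invertible_A_0: "invertible (A - mat 0)"
  using invertible_A by simp

lemma invertible_w_0: "0 \<le> x \<Longrightarrow> invertible (w x 0)"
  using invertible_w[of x 0] invertible_A_0 by simp

lemma matrix_inv_w_0: "0 \<le> x \<Longrightarrow> matrix_inv (w x 0) = jmat ** ctranspose (w x 0) ** jmat"
  using w_left_inverse[of x 0] invertible_A_0 by (intro matrix_inv_unique) simp

text \<open>The coefficient in \<open>w y = y - \<i> N q\<close>.  Its derivative (\<open>q_derivative\<close>) involves \<open>y\<close> only through
  \<open>b w y\<close>, which makes \<open>q\<close> controllable when \<open>b w y\<close> is square integrable.\<close>
definition q :: "complex \<Rightarrow> (real \<Rightarrow> complex ^ 'k ^ ('p + 'p)) \<Rightarrow> real \<Rightarrow> complex ^ 'k ^ 'n"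
  where "q z y x = T x ** (R z ** (\<Lambda> x ** y x))"

lemma w_solution: "w x z ** y x = y x - \<i> *c (N x ** q z y x)"
  by (simp add: w_mult q_def)

text \<open>Differentiating \<open>R \<Lambda> y\<close> gives \<open>- \<i> \<Lambda> j H y\<close>, since \<open>R A = 1 + z R\<close> lets the \<open>z\<close>-dependent terms
  cancel; the derivative of \<open>T\<close> completes \<open>y\<close> to \<open>w y\<close>.\<close>
lemma q_derivative:
  assumes "0 \<le> x" and z: "invertible (A - mat z)" and y: "canonical_solution H z y"
  shows "(q z y has_vector_derivative (- \<i>) *c (T x ** (\<Lambda> x ** (jmat ** (H x ** (w x z ** y x))))))
    (at x within {0..})"
  unfolding q_def
  by (rule has_vector_derivative_eq_rhs, (rule has_vector_derivative_matrix_mult_const_left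
        has_vector_derivative_matrix_mult T_derivative[OF assms(1)]
        \<Lambda>_derivative'[OF assms(1)] canonical_solutionD[OF y assms(1)])+)
    (simp add: w_mult matrix_mult_linear cscale_linear R_A[OF z] flip: matrix_mul_assoc)

text \<open>The commutator of \<open>j H\<close> and \<open>N T \<Lambda>\<close>.\<close>
definition potential :: "real \<Rightarrow> complex ^ ('p + 'p) ^ ('p + 'p)"
  where "potential x = jmat ** H x ** N x ** T x ** \<Lambda> x - N x ** T x ** \<Lambda> x ** jmat ** H x"

text \<open>The transformed function solves the original equation perturbed by a potential independent of \<open>z\<close>.
  Multiplication by \<open>w(x, 0)\<^sup>-\<^sup>1\<close> later gauges this potential away.\<close>
lemma w_solution_derivative:
  assumes "0 \<le> x" and z: "invertible (A - mat z)" and y: "canonical_solution H z y"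
  shows "((\<lambda>x. w x z ** y x) has_vector_derivative
    (\<i> * z) *c (jmat ** (H x ** (w x z ** y x))) + potential x ** (w x z ** y x)) (at x within {0..})"
  unfolding w_solution
proof (rule has_vector_derivative_eq_rhs, (rule has_vector_derivative_diff has_vector_derivative_cscale
        has_vector_derivative_matrix_mult N_derivative[OF assms(1)] q_derivative[OF assms]
        canonical_solutionD[OF y assms(1)])+)
  let ?f = "w x z ** y x" and ?q = "q z y x"
  \<comment> \<open>The relation between \<open>A\<^sup>* T\<close> and \<open>T A\<close> expresses \<open>A\<^sup>* q\<close> by \<open>w y\<close> and \<open>q\<close>.\<close>
  have "ctranspose A ** ?q = T x ** (A ** (R z ** (\<Lambda> x ** y x))) - \<i> *c (T x ** (\<Lambda> x ** (N x ** ?q)))"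
    by (simp add: q_def T_identity assms(1))
  also have "\<dots> = T x ** (\<Lambda> x ** ?f) + z *c ?q"
    by (simp add: A_R[OF z] matrix_mult_linear w_solution q_def)
  finally have Aq: "ctranspose A ** ?q = T x ** (\<Lambda> x ** ?f) + z *c ?q" .
  have "\<i> * z * \<i> = - z"
    by (simp add: complex_eq_iff)
  have f: "y x = ?f + \<i> *c (N x ** ?q)"
    by (simp add: w_solution)
  show "(\<i> * z) *c (jmat ** H x ** y x) -
    \<i> *c (N x ** (- \<i>) *c (T x ** (\<Lambda> x ** (jmat ** (H x ** ?f)))) +
      \<i> *c (jmat ** (H x ** (N x ** ctranspose A))) ** ?q) =
    (\<i> * z) *c (jmat ** (H x ** (y x - \<i> *c (N x ** ?q)))) +
    potential x ** (y x - \<i> *c (N x ** ?q))"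
    unfolding w_solution[symmetric]
    by (subst f) (simp add: potential_def Aq \<open>\<i> * z * \<i> = - z\<close> matrix_mult_linear cscale_linear flip: matrix_mul_assoc)
qed

text \<open>The case \<open>z = 0\<close>, \<open>y = 1\<close> of \<open>w_solution_derivative\<close>.\<close>
lemma w_derivative: "0 \<le> x \<Longrightarrow> ((\<lambda>x. w x 0) has_vector_derivative potential x ** w x 0) (at x within {0..})"
  using w_solution_derivative[OF _ invertible_A_0, of x "\<lambda>_. mat 1"]
  by (simp add: canonical_solution_def cscale_linear)

definition b' :: "real \<Rightarrow> complex ^ ('p + 'p) ^ 'p"
  where "b' x = b x ** w x 0"

lemma continuous_w_0: "continuous_on {0..} (\<lambda>x. w x 0)"
  by (rule has_vector_derivative_continuous_on) (use w_derivative in auto)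

lemma continuous_b': "continuous_on {0..} b'"
  unfolding b'_def by (intro continuous_intros continuous_b continuous_w_0)

text \<open>By \<open>w_derivative\<close> the potential cancels when \<open>w(x, z) y\<close> is multiplied by \<open>w(x, 0)\<^sup>-\<^sup>1\<close>, and
  \<open>w(x, 0)\<^sup>-\<^sup>1 j = j w(x, 0)\<^sup>*\<close> turns \<open>j b\<^sup>* b\<close> into \<open>j b'\<^sup>* b'\<close>.\<close>
theorem darboux_solution:
  assumes z: "invertible (A - mat z)" and y: "canonical_solution H z y"
  shows "canonical_solution (hamiltonian b') z (\<lambda>x. v\<^sub>A A \<Lambda> S x z ** y x)"
  unfolding canonical_solution_def
proof (intro allI impI)
  fix x :: real assume x: "0 \<le> x"
  let ?V = "matrix_inv (w x 0)" and ?f = "w x z ** y x"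
  have inv: "w x 0 ** (?V ** Y) = Y" for Y :: "complex ^ 'k ^ ('p + 'p)"
    by (simp add: matrix_inv_right_cancel invertible_w_0 x)
  have "((\<lambda>x. matrix_inv (w x 0) ** (w x z ** y x)) has_vector_derivative
      ?V ** ((\<i> * z) *c (jmat ** (H x ** ?f)) + potential x ** ?f)
      + - (?V ** (potential x ** w x 0) ** ?V) ** ?f) (at x within {0..})"
    by (rule has_vector_derivative_matrix_mult has_vector_derivative_matrix_inv w_derivative[OF x]
        w_solution_derivative[OF x z y] continuous_w_0 | use invertible_w_0 x in simp)+
  moreover have "?V ** ((\<i> * z) *c (jmat ** (H x ** ?f)) + potential x ** ?f)
      + - (?V ** (potential x ** w x 0) ** ?V) ** ?f = (\<i> * z) *c (?V ** (jmat ** (H x ** ?f)))"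
    by (simp add: matrix_mult_linear inv flip: matrix_mul_assoc)
  moreover have "?V ** (jmat ** (H x ** ?f)) = jmat ** (hamiltonian b' x ** (?V ** ?f))"
    by (simp add: matrix_inv_w_0[OF x] hamiltonian_def b'_def ctranspose_simps jmat_jmat
        inv[unfolded matrix_inv_w_0[OF x], simplified matrix_mul_assoc[symmetric]]
        flip: matrix_mul_assoc)
  ultimately show "((\<lambda>x. v\<^sub>A A \<Lambda> S x z ** y x) has_vector_derivative
      (\<i> * z) *c (jmat ** hamiltonian b' x ** (v\<^sub>A A \<Lambda> S x z ** y x))) (at x within {0..})"
    by (simp add: v\<^sub>A_def flip: matrix_mul_assoc)
qed

lemma b'_darboux_solution: "0 \<le> x \<Longrightarrow> b' x ** (v\<^sub>A A \<Lambda> S x z ** Y) = b x ** (w x z ** Y)"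
  by (simp add: b'_def v\<^sub>A_def matrix_inv_right_cancel invertible_w_0 flip: matrix_mul_assoc)

lemma jform_v:
  assumes "0 \<le> x"
  shows "jform (v\<^sub>A A \<Lambda> S x z ** Y) = jform (w x z ** Y)"
proof -
  have "jform (w x 0 ** U) = jform U" for U :: "complex ^ 'k ^ ('p + 'p)"
    using w_inner[OF assms invertible_A_0 invertible_A_0, of U U] by (simp add: jform_def cscale_linear)
  from this[of "v\<^sub>A A \<Lambda> S x z ** Y"] show ?thesis
    by (simp add: v\<^sub>A_def matrix_inv_right_cancel invertible_w_0 assms flip: matrix_mul_assoc)
qed

end

section \<open>Exponential solutions of the initial system\<close>

text \<open>The lower entry of the eigenvector for the exponent \<open>\<zeta>\<close>, where \<open>\<zeta>\<close> is one of the two roots of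
  \<open>\<zeta>\<^sup>2 = c (2 z + c)\<close>.  The two ratios are inverse to each other.\<close>
definition ratio :: "real \<Rightarrow> complex \<Rightarrow> complex \<Rightarrow> complex"
  where "ratio c z \<zeta> = 1 / z * (z + of_real c - \<zeta>)"

text \<open>In the rotating frame \<open>exp (\<i> c x j)\<close> the initial system has constant coefficients; this is its
  solution with exponent \<open>\<zeta>\<close>, written in the original frame.\<close>
definition mode :: "real \<Rightarrow> complex ^ 'p ^ 'p \<Rightarrow> complex \<Rightarrow> complex \<Rightarrow> real \<Rightarrow> complex ^ 'p ^ ('p::finite + 'p)"
  where "mode c \<alpha> z \<zeta> x =
    exp (\<i> * (\<zeta> - of_real c) * of_real x) *c vstack (- \<alpha>) 0 +
    exp (\<i> * (\<zeta> + of_real c) * of_real x) *c vstack 0 (ratio c z \<zeta> *c mat 1)"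

lemma mode_0: "mode c \<alpha> z (z\<^sub>1 z) 0 = E\<^sub>1 c \<alpha> z\<^sub>1 z"
  by (simp add: mode_def E\<^sub>1_def ratio_def vstack_add cscale_linear)

lemma mode_vstack: "mode c \<alpha> z \<zeta> x =
    vstack (- (exp (\<i> * (\<zeta> - of_real c) * of_real x) *c \<alpha>))
      ((exp (\<i> * (\<zeta> + of_real c) * of_real x) * ratio c z \<zeta>) *c mat 1)"
  by (simp add: mode_def vstack_cscale vstack_add cscale_linear)

lemma exp_has_vector_derivative:
  "((\<lambda>x. exp (a * of_real x)) has_vector_derivative a * exp (a * of_real x)) (at x within U)"
  for a :: complex
proof -
  have "((\<lambda>t. exp (a * t)) has_field_derivative a * exp (a * of_real x)) (at (of_real x))"
    by (auto intro!: derivative_eq_intros)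
  from has_vector_derivative_real_field[OF this] show ?thesis .
qed

text \<open>The algebraic form of the energy identity on the decaying solution:
  \<open>Im \<zeta> (1 - |s|\<^sup>2) = Im z |1 - s|\<^sup>2\<close> for \<open>s = ratio c z \<zeta>\<close>.  Both eigenvector equations together give
  \<open>\<zeta> (1 - s cnj s) = z |1 - s|\<^sup>2 + c (1 + |s|\<^sup>2)\<close>, and \<open>s = 1\<close> would make \<open>\<zeta> = c\<close> real.\<close>
lemma ratio_less_1:
  assumes z: "0 < Im z" and \<zeta>: "\<zeta>\<^sup>2 = of_real c * (2 * z + of_real c)" "0 < Im \<zeta>"
  shows "cmod (ratio c z \<zeta>) < 1"
proof -
  let ?s = "ratio c z \<zeta>"
  have "z \<noteq> 0" using z by auto
  then have s: "z * ?s = z + of_real c - \<zeta>"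
    by (simp add: ratio_def)
  have "z * (\<zeta> * ?s) = \<zeta> * (z + of_real c - \<zeta>)"
    using s by (metis mult.left_commute)
  also have "\<dots> = z * z - (of_real c + z) * (z + of_real c - \<zeta>)"
    using \<zeta>(1) by (simp add: algebra_simps power2_eq_square)
  also have "\<dots> = z * (z - (of_real c + z) * ?s)"
    by (simp add: s[symmetric] algebra_simps)
  \<comment> \<open>The second eigenvector equation; the first is \<open>s\<close>.\<close>
  finally have s': "\<zeta> * ?s = z - (of_real c + z) * ?s"
    using \<open>z \<noteq> 0\<close> by simp
  have sq: "w * cnj w = of_real ((cmod w)\<^sup>2)" for w
    by (rule complex_norm_square[symmetric])
  have "\<zeta> * (1 - ?s * cnj ?s) = \<zeta> - (\<zeta> * ?s) * cnj ?s"
    by (simp add: algebra_simps)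
  also have "\<dots> = (z + of_real c - z * ?s) - (z - (of_real c + z) * ?s) * cnj ?s"
    unfolding s' by (simp add: s)
  also have "\<dots> = z * ((1 - ?s) * cnj (1 - ?s)) + of_real c * (1 + ?s * cnj ?s)"
    by (simp add: algebra_simps)
  finally have "Im (\<zeta> * of_real (1 - (cmod ?s)\<^sup>2)) =
      Im (z * of_real ((cmod (1 - ?s))\<^sup>2) + of_real (c * (1 + (cmod ?s)\<^sup>2)))"
    by (simp only: sq of_real_diff of_real_1 of_real_mult of_real_add)
  then have "Im \<zeta> * (1 - (cmod ?s)\<^sup>2) = Im z * (cmod (1 - ?s))\<^sup>2"
    by simp
  moreover have "1 - ?s \<noteq> 0"
    using s \<zeta>(2) by (auto simp: complex_eq_iff)
  ultimately have "0 < Im \<zeta> * (1 - (cmod ?s)\<^sup>2)"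
    using z by simp
  then have "(cmod ?s)\<^sup>2 < 1" using \<zeta>(2) by (simp add: zero_less_mult_iff)
  then show ?thesis by (simp add: power_less_one_iff)
qed

lemma continuous_beta: "continuous_on {0..} (beta c \<alpha>)"
  unfolding beta_def hstack_def
proof (rule continuous_on_matrixI)
  fix i k
  show "continuous_on {0..} (\<lambda>x. (\<chi> i s. case s of
      Inl k \<Rightarrow> (exp (\<i> * of_real (c * x)) *c mat 1) $ i $ k
    | Inr l \<Rightarrow> (exp (- \<i> * of_real (c * x)) *c \<alpha>) $ i $ l) $ i $ k)"
    by (cases k) (auto simp: cscale_def intro!: continuous_intros)
qed

lemma norm_beta: "norm (beta c \<alpha> x) = norm (beta c \<alpha> 0)"
proof -
  have "(norm (beta c \<alpha> x))\<^sup>2 = (norm (beta c \<alpha> 0))\<^sup>2"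
    unfolding norm_matrix_squared
    by (simp add: beta_def hstack_def sum_UNIV_sum cscale_def norm_mult)
  then show ?thesis by (simp add: power2_eq_iff_nonneg)
qed

context
  fixes c :: real and \<alpha> :: "complex ^ 'p ^ ('p :: finite)"
  assumes \<alpha>_unitary: "\<alpha> ** ctranspose \<alpha> = mat 1"
begin

lemma \<alpha>_unitary': "ctranspose \<alpha> ** \<alpha> = mat 1"
  using \<alpha>_unitary by (simp add: matrix_left_right_inverse)

lemma norm_\<alpha>_mult: "norm (\<alpha> ** a) = norm (a :: complex ^ 'k ^ 'p)"
proof -
  have "inner (\<alpha> ** a) (\<alpha> ** a) = inner a a"
    by (simp add: inner_mult_left matrix_mul_assoc \<alpha>_unitary')
  then show ?thesis by (simp add: norm_eq_sqrt_inner)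
qed

lemma beta_mode: "beta c \<alpha> x ** mode c \<alpha> z \<zeta> x = ((ratio c z \<zeta> - 1) * exp (\<i> * \<zeta> * of_real x)) *c \<alpha>"
proof -
  let ?p = "exp (\<i> * of_real (c * x))" and ?m = "exp (- \<i> * of_real (c * x))"
  let ?e1 = "exp (\<i> * (\<zeta> - of_real c) * of_real x)" and ?e2 = "exp (\<i> * (\<zeta> + of_real c) * of_real x)"
  have e: "?p * ?e1 = exp (\<i> * \<zeta> * of_real x)" "?m * ?e2 = exp (\<i> * \<zeta> * of_real x)"
    by (simp_all add: exp_add[symmetric] algebra_simps)
  have "(p *c mat 1) ** (- (r *c \<alpha>)) + (m *c \<alpha>) ** ((t * s) *c mat 1) = (s * (m * t) - p * r) *c \<alpha>"
    for p m r s t :: complex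
    by (simp add: matrix_mult_linear cscale_linear mult_ac)
  then have "beta c \<alpha> x ** mode c \<alpha> z \<zeta> x = (ratio c z \<zeta> * (?m * ?e2) - ?p * ?e1) *c \<alpha>"
    unfolding beta_def mode_vstack hstack_mult_vstack .
  then show ?thesis
    unfolding e left_diff_distrib mult_1_left .
qed

lemma mode_solution:
  assumes "z \<noteq> 0" and \<zeta>: "\<zeta>\<^sup>2 = of_real c * (2 * z + of_real c)"
  shows "canonical_solution (hamiltonian (beta c \<alpha>)) z (mode c \<alpha> z \<zeta>)"
  unfolding canonical_solution_def
proof (intro allI impI)
  fix x :: real
  let ?s = "ratio c z \<zeta>"
  let ?e1 = "exp (\<i> * (\<zeta> - of_real c) * of_real x)" and ?e2 = "exp (\<i> * (\<zeta> + of_real c) * of_real x)"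
  have s: "z * ?s = z + of_real c - \<zeta>"
    using \<open>z \<noteq> 0\<close> by (simp add: ratio_def)
  have "z * ((\<zeta> + of_real c) * ?s) = (\<zeta> + of_real c) * (z + of_real c - \<zeta>)"
    using s by (metis mult.left_commute)
  also have "\<dots> = z * (\<zeta> - of_real c)"
    using \<zeta> by (simp add: algebra_simps power2_eq_square)
  \<comment> \<open>The second eigenvector equation; the first is \<open>s\<close>.\<close>
  finally have s': "(\<zeta> + of_real c) * ?s = \<zeta> - of_real c"
    using \<open>z \<noteq> 0\<close> by simp
  have e: "cnj (exp (\<i> * of_real (c * x))) * exp (\<i> * \<zeta> * of_real x) = ?e1"
    "cnj (exp (- \<i> * of_real (c * x))) * exp (\<i> * \<zeta> * of_real x) = ?e2"
    by (simp_all add: exp_cnj exp_add[symmetric] algebra_simps)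
  have "ctranspose (beta c \<alpha> x) ** (beta c \<alpha> x ** mode c \<alpha> z \<zeta> x) =
      vstack ((cnj (exp (\<i> * of_real (c * x))) * ((?s - 1) * exp (\<i> * \<zeta> * of_real x))) *c \<alpha>)
        ((cnj (exp (- \<i> * of_real (c * x))) * ((?s - 1) * exp (\<i> * \<zeta> * of_real x))) *c mat 1)"
    unfolding beta_mode
    unfolding beta_def ctranspose_hstack vstack_mult ctranspose_cscale
    by (simp add: matrix_mult_linear cscale_linear ctranspose_mat \<alpha>_unitary' mult_ac)
  also have "\<dots> = vstack (((?s - 1) * ?e1) *c \<alpha>) (((?s - 1) * ?e2) *c mat 1)"
    unfolding e[symmetric] by (simp only: mult_ac)
  finally have H: "jmat ** hamiltonian (beta c \<alpha>) x ** mode c \<alpha> z \<zeta> x =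
      vstack (((?s - 1) * ?e1) *c \<alpha>) (- (((?s - 1) * ?e2) *c mat 1))"
    by (simp add: hamiltonian_def jmat_mult_vstack flip: matrix_mul_assoc)
  have "(mode c \<alpha> z \<zeta> has_vector_derivative
      (\<i> * (\<zeta> - of_real c) * ?e1) *c vstack (- \<alpha>) 0 + (\<i> * (\<zeta> + of_real c) * ?e2) *c vstack 0 (?s *c mat 1))
      (at x within {0..})"
    unfolding mode_def
    by (rule has_vector_derivative_add
        bounded_linear.has_vector_derivative[OF bounded_bilinear.bounded_linear_left[OF bounded_bilinear_cscale]]
        exp_has_vector_derivative)+
  moreover have "(\<i> * (\<zeta> - of_real c) * ?e1) *c vstack (- \<alpha>) 0 + (\<i> * (\<zeta> + of_real c) * ?e2) *c vstack 0 (?s *c mat 1)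
      = (\<i> * z) *c (jmat ** hamiltonian (beta c \<alpha>) x ** mode c \<alpha> z \<zeta> x)"
  proof -
    have "- (\<i> * (\<zeta> - of_real c) * ?e1) = \<i> * z * ((?s - 1) * ?e1)"
    proof -
      have "- (\<zeta> - of_real c) = z * ?s - z" using s by simp
      then have "\<i> * (- (\<zeta> - of_real c)) * ?e1 = \<i> * (z * ?s - z) * ?e1" by simp
      then show ?thesis by (simp add: algebra_simps)
    qed
    moreover have "\<i> * (\<zeta> + of_real c) * ?e2 * ?s = - (\<i> * z * ((?s - 1) * ?e2))"
    proof -
      have "(\<zeta> + of_real c) * ?s = z - z * ?s" using s s' by simp
      then have "\<i> * ((\<zeta> + of_real c) * ?s) * ?e2 = \<i> * (z - z * ?s) * ?e2" by simp
      then show ?thesis by (simp add: algebra_simps)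
    qed
    ultimately show ?thesis
      unfolding H
      by (simp only: vstack_cscale vstack_add cscale_zero cscale_cscale cscale_minus(1)
          cscale_minus(2)[symmetric] mult_minus_right add_0_left add_0_right)
  qed
  ultimately show "(mode c \<alpha> z \<zeta> has_vector_derivative
      (\<i> * z) *c (jmat ** hamiltonian (beta c \<alpha>) x ** mode c \<alpha> z \<zeta> x)) (at x within {0..})"
    by simp
qed

lemma jform_mode:
  "jform (mode c \<alpha> z \<zeta> x ** a) = (exp (- (Im \<zeta> * x)))\<^sup>2 * (1 - (cmod (ratio c z \<zeta>))\<^sup>2) * (norm a)\<^sup>2"
  by (simp add: mode_vstack vstack_mult jform_vstack matrix_mult_linear norm_cscale norm_\<alpha>_mult
      norm_mult power_mult_distrib algebra_simps)

text \<open>The upper entries of both eigenvectors are \<open>- \<alpha>\<close>, and their lower entries differ by \<open>2 \<zeta> / z\<close>.\<close>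
lemma modes_span:
  assumes "z \<noteq> 0" "\<zeta> \<noteq> 0"
  shows "\<exists>a d. g = mode c \<alpha> z \<zeta> 0 ** a + mode c \<alpha> z (- \<zeta>) 0 ** (d :: complex ^ 'k ^ 'p)"
proof -
  let ?s = "ratio c z \<zeta>" and ?s' = "ratio c z (- \<zeta>)"
  obtain g1 g2 where g: "g = vstack g1 g2" using vstack_blocks by blast
  have "?s' - ?s = 2 * \<zeta> / z"
    by (simp add: ratio_def algebra_simps)
  then have ne: "?s' - ?s \<noteq> 0" using assms by simp
  define e where "e = - (ctranspose \<alpha> ** g1)"
  define d where "d = (1 / (?s' - ?s)) *c (g2 - ?s *c e)"
  have "\<alpha> ** e = - g1"
    by (simp add: e_def matrix_mult_linear matrix_mul_assoc \<alpha>_unitary)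
  then have "- (\<alpha> ** (e - d)) + - (\<alpha> ** d) = g1"
    by (simp add: matrix_mult_diff_right)
  moreover have "?s *c (e - d) + ?s' *c d = ?s *c e + (?s' - ?s) *c d"
    by (simp add: cscale_linear)
  then have "?s *c (e - d) + ?s' *c d = g2"
    using ne by (simp add: d_def cscale_cscale cscale_one)
  moreover have "mode c \<alpha> z \<zeta> 0 ** X = vstack (- (\<alpha> ** X)) (ratio c z \<zeta> *c X)"
    for \<zeta> and X :: "complex ^ 'k ^ 'p"
    by (simp add: mode_vstack vstack_mult matrix_mult_linear cscale_linear)
  ultimately have "g = mode c \<alpha> z \<zeta> 0 ** (e - d) + mode c \<alpha> z (- \<zeta>) 0 ** d"
    by (simp only: g vstack_add)
  then show ?thesis by blast
qed

end

section \<open>Square integrable solutions do not grow\<close>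

context darboux
begin

text \<open>Gronwall's argument: \<open>exp (- 2 K x) |\<Lambda>|\<^sup>2\<close> is nonincreasing.\<close>
lemma \<Lambda>_growth:
  assumes B: "\<And>x. 0 \<le> x \<Longrightarrow> norm (b x) \<le> B" and "0 \<le> x"
  shows "norm (\<Lambda> x) \<le> norm (\<Lambda> 0) * exp (norm A * norm (jmat :: complex ^ ('p + 'p) ^ ('p + 'p)) * B\<^sup>2 * x)"
proof -
  define K where "K = norm A * norm (jmat :: complex ^ ('p + 'p) ^ ('p + 'p)) * B\<^sup>2"
  let ?\<Lambda>' = "\<lambda>x. (- \<i>) *c (A ** (\<Lambda> x ** (jmat ** H x)))"
  let ?g = "\<lambda>x. - (exp (- 2 * K * x) * inner (\<Lambda> x) (\<Lambda> x))"
  have "?g 0 \<le> ?g x"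
  proof (rule nondecreasing_by_derivative)
    fix x :: real assume x: "0 \<le> x"
    have "((\<lambda>x. exp (- 2 * K * x)) has_vector_derivative (- 2 * K) * exp (- 2 * K * x)) (at x within {0..})"
      by (auto intro!: derivative_eq_intros simp: has_real_derivative_iff_has_vector_derivative[symmetric])
    then show "(?g has_vector_derivative
        - (exp (- 2 * K * x) * (inner (\<Lambda> x) (?\<Lambda>' x) + inner (?\<Lambda>' x) (\<Lambda> x))
          + (- 2 * K) * exp (- 2 * K * x) * inner (\<Lambda> x) (\<Lambda> x))) (at x within {0..})"
      by (intro has_vector_derivative_minus has_vector_derivative_mult has_vector_derivative_inner
          \<Lambda>_derivative' x)
    have "0 \<le> B"
      using B[OF x] norm_ge_zero[of "b x"] by linarith
    then have "norm (H x) \<le> B * B"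
      unfolding hamiltonian_def using B[OF x]
      by (intro order_trans[OF norm_matrix_mult_le] mult_mono) (auto simp: norm_ctranspose)
    have "norm (?\<Lambda>' x) \<le> norm A * (norm (\<Lambda> x) * (norm (jmat :: complex ^ ('p + 'p) ^ ('p + 'p)) * (B * B)))"
      unfolding norm_cscale using \<open>norm (H x) \<le> B * B\<close>
      by (simp, intro order_trans[OF norm_matrix_mult_le] mult_left_mono) auto
    also have "\<dots> = K * norm (\<Lambda> x)"
      by (simp add: K_def power2_eq_square)
    finally have "norm (\<Lambda> x) * norm (?\<Lambda>' x) \<le> norm (\<Lambda> x) * (K * norm (\<Lambda> x))"
      by (intro mult_left_mono) auto
    then have "inner (\<Lambda> x) (?\<Lambda>' x) \<le> K * inner (\<Lambda> x) (\<Lambda> x)"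
      using norm_cauchy_schwarz[of "\<Lambda> x" "?\<Lambda>' x"] by (simp add: dot_square_norm power2_eq_square mult_ac)
    then have "exp (- 2 * K * x) * (2 * inner (\<Lambda> x) (?\<Lambda>' x)) \<le> exp (- 2 * K * x) * (2 * (K * inner (\<Lambda> x) (\<Lambda> x)))"
      by (intro mult_left_mono) auto
    then show "0 \<le> - (exp (- 2 * K * x) * (inner (\<Lambda> x) (?\<Lambda>' x) + inner (?\<Lambda>' x) (\<Lambda> x))
          + (- 2 * K) * exp (- 2 * K * x) * inner (\<Lambda> x) (\<Lambda> x))"
      by (simp add: inner_commute[of "?\<Lambda>' x"] algebra_simps)
  qed fact
  then have "exp (- 2 * K * x) * (norm (\<Lambda> x))\<^sup>2 \<le> (norm (\<Lambda> 0))\<^sup>2"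
    by (simp add: dot_square_norm)
  note bound = this
  have e: "exp (2 * K * x) * exp (- 2 * K * x) = 1" "exp (2 * K * x) = (exp (K * x))\<^sup>2"
    by (simp_all add: exp_add[symmetric] exp_double[symmetric])
  have "(norm (\<Lambda> x))\<^sup>2 = exp (2 * K * x) * (exp (- 2 * K * x) * (norm (\<Lambda> x))\<^sup>2)"
    unfolding mult.assoc[symmetric] e(1) by simp
  also have "\<dots> \<le> exp (2 * K * x) * (norm (\<Lambda> 0))\<^sup>2"
    using bound by (rule mult_left_mono) simp
  also have "\<dots> = (norm (\<Lambda> 0) * exp (K * x))\<^sup>2"
    unfolding e(2) power_mult_distrib by (rule mult.commute)
  finally have "(norm (\<Lambda> x))\<^sup>2 \<le> (norm (\<Lambda> 0) * exp (K * x))\<^sup>2" .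
  then show ?thesis
    by (simp add: K_def[symmetric] power2_le_iff_abs_le)
qed

text \<open>With \<open>G = b N\<close> and \<open>f = b w y\<close> one has \<open>q' = - \<i> (G T)\<^sup>* f\<close>, so
  \<open>2 |q'| \<le> |G T|\<^sup>2 + |f|\<^sup>2\<close>.  Both terms are integrable: \<open>|G T|\<^sup>2 = - (tr T)'\<close> and \<open>tr T \<ge> 0\<close>,
  while \<open>|f|\<^sup>2\<close> is dominated by the derivative of the bounded function \<open>\<Psi>\<close>.\<close>
lemma q_bounded:
  fixes y :: "real \<Rightarrow> complex ^ 'k ^ ('p + 'p)"
  assumes z: "invertible (A - mat z)" and y: "canonical_solution H z y"
    and \<Psi>: "\<And>x. 0 \<le> x \<Longrightarrow> (\<Psi> has_vector_derivative \<psi> x) (at x within {0..})"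
    and \<psi>: "\<And>x. 0 \<le> x \<Longrightarrow> (norm (b x ** (w x z ** y x)))\<^sup>2 \<le> \<psi> x"
    and bound: "\<And>x. 0 \<le> x \<Longrightarrow> \<Psi> x \<le> M"
  shows "\<exists>C. \<forall>x\<ge>0. norm (q z y x) \<le> C"
proof -
  let ?f = "\<lambda>x. b x ** (w x z ** y x)"
  let ?I = "mat 1 :: complex ^ 'n ^ 'n"
  let ?\<phi> = "\<lambda>x. (1 / 2) *\<^sub>R (\<Psi> x - inner ?I (T x))"
  have "norm (q z y x) \<le> norm (q z y 0) + 1 / 2 * (M - \<Psi> 0 + inner ?I (T 0))" if x: "0 \<le> x" for x
  proof -
    have "norm (q z y x - q z y 0) \<le> ?\<phi> x - ?\<phi> 0"
    proof (rule norm_diff_le_by_derivative)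
      fix x :: real assume x: "0 \<le> x"
      show "(q z y has_vector_derivative (- \<i>) *c (T x ** (\<Lambda> x ** (jmat ** (H x ** (w x z ** y x)))))) (at x within {0..})"
        by (rule q_derivative[OF x z y])
      have "inner ?I (T x ** (\<Lambda> x ** (jmat ** (H x ** (N x ** T x))))) = (norm (b x ** (N x ** T x)))\<^sup>2"
      proof -
        have "T x ** (\<Lambda> x ** (jmat ** (H x ** (N x ** T x)))) = ctranspose (b x ** (N x ** T x)) ** (b x ** (N x ** T x))"
          by (simp add: hamiltonian_def ctranspose_mult ctranspose_N T_hermitian x flip: matrix_mul_assoc)
        then show ?thesis
          by (simp add: inner_mult_right ctranspose_ctranspose power2_norm_eq_inner)
      qed
      moreover have "((\<lambda>x. inner ?I (T x)) has_vector_derivative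
          inner ?I (- (T x ** (\<Lambda> x ** (jmat ** (H x ** (N x ** T x))))))) (at x within {0..})"
        by (rule bounded_linear.has_vector_derivative[OF bounded_linear_inner_right T_derivative[OF x]])
      ultimately have "((\<lambda>x. inner ?I (T x)) has_vector_derivative - (norm (b x ** (N x ** T x)))\<^sup>2) (at x within {0..})"
        by simp
      from bounded_linear.has_vector_derivative[OF bounded_linear_scaleR_right has_vector_derivative_diff[OF \<Psi>[OF x] this]]
      show "(?\<phi> has_vector_derivative (1 / 2) *\<^sub>R (\<psi> x - - (norm (b x ** (N x ** T x)))\<^sup>2)) (at x within {0..})" .
    next
      fix x' assume "0 < x'" "x' < x"
      then have x': "0 \<le> x'" by simp
      have "T x' ** (\<Lambda> x' ** (jmat ** (H x' ** (w x' z ** y x')))) = ctranspose (b x' ** (N x' ** T x')) ** ?f x'"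
        by (simp add: hamiltonian_def ctranspose_mult ctranspose_N T_hermitian x' flip: matrix_mul_assoc)
      then have "norm ((- \<i>) *c (T x' ** (\<Lambda> x' ** (jmat ** (H x' ** (w x' z ** y x'))))))
          \<le> norm (b x' ** (N x' ** T x')) * norm (?f x')"
        using norm_matrix_mult_le[of "ctranspose (b x' ** (N x' ** T x'))" "?f x'"]
        by (simp add: norm_cscale norm_ctranspose)
      also have "\<dots> \<le> (1 / 2) * ((norm (b x' ** (N x' ** T x')))\<^sup>2 + (norm (?f x'))\<^sup>2)"
        using sum_squares_bound[of "norm (b x' ** (N x' ** T x'))" "norm (?f x')"] by simp
      also have "\<dots> \<le> (1 / 2) *\<^sub>R (\<psi> x' - - (norm (b x' ** (N x' ** T x')))\<^sup>2)"
        using \<psi>[OF x'] by simp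
      finally show "norm ((- \<i>) *c (T x' ** (\<Lambda> x' ** (jmat ** (H x' ** (w x' z ** y x'))))))
          \<le> (1 / 2) *\<^sub>R (\<psi> x' - - (norm (b x' ** (N x' ** T x')))\<^sup>2)" .
    qed (use x in auto)
    moreover have "0 \<le> inner ?I (T x)"
    proof -
      have "S x ** T x = mat 1"
        using S_T[OF x, of "mat 1"] by simp
      then show ?thesis
        using S_nonneg[OF x, of "T x"] by (simp only: inner_commute[of ?I])
    qed
    ultimately show ?thesis
      using bound[OF x] norm_triangle_sub[of "q z y x" "q z y 0"]
      by (simp add: diff_divide_distrib add_divide_distrib)
  qed
  then show ?thesis by blast
qed

text \<open>If \<open>b w y\<close> is square integrable, then \<open>b y\<close> differs from it by \<open>\<i> b N q\<close>, which grows at most as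
  fast as \<open>\<Lambda>\<close>.\<close>
lemma square_integrable_growth:
  fixes y :: "real \<Rightarrow> complex ^ 'k ^ ('p + 'p)"
  assumes B: "\<And>x. 0 \<le> x \<Longrightarrow> norm (b x) \<le> B"
    and z: "invertible (A - mat z)" and y: "canonical_solution H z y"
    and \<Psi>: "\<And>x. 0 \<le> x \<Longrightarrow> (\<Psi> has_vector_derivative \<psi> x) (at x within {0..})"
    and \<psi>: "\<And>x. 0 \<le> x \<Longrightarrow> (norm (b x ** (w x z ** y x)))\<^sup>2 \<le> \<psi> x"
    and bound: "\<And>x. 0 \<le> x \<Longrightarrow> \<Psi> x \<le> M"
  shows "\<exists>C. \<forall>x\<ge>0. norm (b x ** y x) \<le> norm (b x ** (w x z ** y x)) +
    C * exp (norm A * norm (jmat :: complex ^ ('p + 'p) ^ ('p + 'p)) * B\<^sup>2 * x)"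
proof -
  let ?J = "norm (jmat :: complex ^ ('p + 'p) ^ ('p + 'p))"
  obtain C where C: "\<And>x. 0 \<le> x \<Longrightarrow> norm (q z y x) \<le> C"
    using q_bounded[OF z y \<Psi> \<psi> bound] by blast
  have "norm (b x ** y x) \<le> norm (b x ** (w x z ** y x)) + (B * (?J * norm (\<Lambda> 0)) * C) * exp (norm A * ?J * B\<^sup>2 * x)"
    if x: "0 \<le> x" for x
  proof -
    have "b x ** y x = b x ** (w x z ** y x) + \<i> *c (b x ** (N x ** q z y x))"
      by (simp add: w_solution matrix_mult_linear)
    then have "norm (b x ** y x) \<le> norm (b x ** (w x z ** y x)) + norm (b x ** (N x ** q z y x))"
      using norm_triangle_ineq[of "b x ** (w x z ** y x)" "\<i> *c (b x ** (N x ** q z y x))"]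
      by (simp add: norm_cscale)
    also have "norm (b x ** (N x ** q z y x)) \<le> norm (b x) * (norm (N x) * norm (q z y x))"
      by (intro order_trans[OF norm_matrix_mult_le] mult_left_mono norm_matrix_mult_le norm_ge_zero)
    also have "\<dots> \<le> B * ((?J * (norm (\<Lambda> 0) * exp (norm A * ?J * B\<^sup>2 * x))) * C)"
    proof (intro mult_mono B x C)
      show "norm (N x) \<le> ?J * (norm (\<Lambda> 0) * exp (norm A * ?J * B\<^sup>2 * x))"
        unfolding N_def using \<Lambda>_growth[OF B x]
        by (intro order_trans[OF norm_matrix_mult_le] mult_left_mono) (auto simp: norm_ctranspose)
      show "0 \<le> B" using B[OF x] norm_ge_zero[of "b x"] by linarith
    qed auto
    finally show ?thesis by (simp add: mult_ac)
  qed
  then show ?thesis by blast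
qed

end

section \<open>The Weyl function\<close>

lemma vstack_projections: "vstack (hstack (mat 1) 0 ** Y) (hstack 0 (mat 1) ** Y) = Y"
  using vstack_blocks[of Y] by (auto simp: hstack_mult_vstack matrix_mult_linear)

text \<open>The condition \<open>0 < Im \<zeta>\<close> selects \<open>\<i> csqrt (- c (2 z + c))\<close>, whose radicand avoids the cut for
  \<open>z\<close> in the upper half-plane.\<close>
lemma holomorphic_root:
  fixes c :: real and \<zeta> :: "complex \<Rightarrow> complex"
  assumes "c \<noteq> 0"
    and \<zeta>: "\<And>z. z \<in> \<complex>\<^sub>+ \<Longrightarrow> \<zeta> z ^ 2 = of_real c * (2 * z + of_real c) \<and> 0 < Im (\<zeta> z)"
  shows "\<zeta> holomorphic_on \<complex>\<^sub>+"
proof -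
  let ?r = "\<lambda>z. - (of_real c * (2 * z + of_real c)) :: complex"
  have r: "?r z \<notin> \<real>\<^sub>\<le>\<^sub>0" if "z \<in> \<complex>\<^sub>+" for z
    using that \<open>c \<noteq> 0\<close> by (auto simp: upper_half_plane_def complex_nonpos_Reals_iff)
  have "(\<lambda>z. \<i> * csqrt (?r z)) holomorphic_on \<complex>\<^sub>+"
    by (intro holomorphic_intros) (use r in auto)
  moreover have "\<i> * csqrt (?r z) = \<zeta> z" if z: "z \<in> \<complex>\<^sub>+" for z
  proof -
    define s where "s = \<i> * csqrt (?r z)"
    have "s\<^sup>2 = (\<zeta> z)\<^sup>2"
      using \<zeta>[OF z] by (simp add: s_def power_mult_distrib)
    then have "s = \<zeta> z \<or> s = - \<zeta> z"
      by (simp add: power2_eq_iff)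
    moreover have "0 \<le> Im s"
      unfolding s_def using Re_csqrt[of "?r z"] by (simp only: Im_i_times)
    ultimately show ?thesis
      unfolding s_def[symmetric] using \<zeta>[OF z] by auto
  qed
  ultimately show ?thesis by (rule holomorphic_transform)
qed

text \<open>The transformation applied to the exponential Hamiltonian.\<close>
locale explicit_system =
  darboux A "beta c \<alpha>" \<Lambda> S
  for A :: "complex ^ 'n ^ 'n" and c :: real and \<alpha> :: "complex ^ 'p ^ ('p :: finite)"
    and \<Lambda> :: "real \<Rightarrow> complex ^ ('p + 'p) ^ 'n" and S :: "real \<Rightarrow> complex ^ 'n ^ 'n" +
  fixes z\<^sub>1 :: "complex \<Rightarrow> complex"
  assumes c_nonzero: "c \<noteq> 0"
    and \<alpha>_unitary: "\<alpha> ** ctranspose \<alpha> = mat 1"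
    and z\<^sub>1: "\<And>z. z \<in> \<complex>\<^sub>+ \<Longrightarrow> z\<^sub>1 z ^ 2 = of_real c * (2 * z + of_real c) \<and> 0 < Im (z\<^sub>1 z)"
begin

abbreviation "v \<equiv> v\<^sub>A A \<Lambda> S"
abbreviation "E \<equiv> E\<^sub>1 c \<alpha> z\<^sub>1"

text \<open>The domain of \<open>w\<^sub>A\<close> in the upper half-plane; its complement there is finite.\<close>
definition regular :: "complex set"
  where "regular = {z \<in> \<complex>\<^sub>+. invertible (A - mat z)}"

text \<open>The image of the decaying exponential solution.\<close>
definition weyl_solution :: "complex \<Rightarrow> complex ^ 'k ^ 'p \<Rightarrow> real \<Rightarrow> complex ^ 'k ^ ('p + 'p)"
  where "weyl_solution z a x = v x z ** (mode c \<alpha> z (z\<^sub>1 z) x ** a)"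

lemma upper_half_planeD: "z \<in> \<complex>\<^sub>+ \<Longrightarrow> 0 < Im z" "z \<in> \<complex>\<^sub>+ \<Longrightarrow> z \<noteq> 0"
  by (auto simp: upper_half_plane_def)

lemma open_upper_half_plane: "open \<complex>\<^sub>+"
  unfolding upper_half_plane_def by (rule open_halfspace_Im_gt)

lemma finite_singular: "finite (\<complex>\<^sub>+ - regular)"
  by (rule finite_subset[OF _ finite_not_invertible_shift[OF invertible_A]]) (auto simp: regular_def)

lemma mode_canonical: "z \<in> \<complex>\<^sub>+ \<Longrightarrow> canonical_solution H z (mode c \<alpha> z (z\<^sub>1 z))"
  by (rule mode_solution[OF \<alpha>_unitary]) (use z\<^sub>1 upper_half_planeD in auto)

lemma weyl_solution_canonical:
  assumes "z \<in> regular"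
  shows "canonical_solution (hamiltonian b') z (weyl_solution z a)"
  unfolding weyl_solution_def
  by (rule darboux_solution) (use assms in \<open>auto simp: regular_def intro!: canonical_solution_mult mode_canonical\<close>)

lemma weyl_solution_0: "weyl_solution z a 0 = v 0 z ** (E z ** a)"
  by (simp add: weyl_solution_def mode_0)

text \<open>The transformation only enlarges the form \<open>jform\<close>, which is positive on the decaying
  exponential solutions.\<close>
lemma jform_weyl_solution:
  assumes z: "z \<in> regular" and "0 \<le> x"
  shows "0 \<le> jform (weyl_solution z a x)" and "a \<noteq> 0 \<Longrightarrow> 0 < jform (weyl_solution z a x)"
proof -
  let ?y = "mode c \<alpha> z (z\<^sub>1 z) x ** a"
  have z': "z \<in> \<complex>\<^sub>+" "invertible (A - mat z)" using z by (auto simp: regular_def)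
  have "cmod (ratio c z (z\<^sub>1 z)) < 1"
    by (rule ratio_less_1) (use z' z\<^sub>1 upper_half_planeD in auto)
  then have r: "0 < 1 - (cmod (ratio c z (z\<^sub>1 z)))\<^sup>2"
    by (simp add: power_less_one_iff)
  have "jform ?y \<le> jform (weyl_solution z a x)"
    unfolding weyl_solution_def jform_v[OF assms(2)]
    by (rule jform_w_mono) (use assms z' upper_half_planeD[of z] in auto)
  moreover have "0 \<le> jform ?y" "a \<noteq> 0 \<Longrightarrow> 0 < jform ?y"
    unfolding jform_mode[OF \<alpha>_unitary] using r by (auto intro!: mult_nonneg_nonneg mult_pos_pos)
  ultimately show "0 \<le> jform (weyl_solution z a x)" "a \<noteq> 0 \<Longrightarrow> 0 < jform (weyl_solution z a x)"
    by auto
qed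

text \<open>The two blocks of \<open>v\<^sub>A E\<^sub>1\<close>, that is, of the initial value of \<open>weyl_solution\<close>.\<close>
abbreviation "upper z \<equiv> hstack (mat 1) 0 ** v 0 z ** E z"
abbreviation "lower z \<equiv> hstack 0 (mat 1) ** v 0 z ** E z"

definition \<phi>\<^sub>0 :: "complex \<Rightarrow> complex ^ 'p ^ 'p"
  where "\<phi>\<^sub>0 z = lower z ** matrix_inv (upper z)"

lemma vstack_upper_lower: "vstack (upper z ** a) (lower z ** a) = weyl_solution z a 0"
  using vstack_projections[of "v 0 z ** (E z ** a)"]
  by (simp add: weyl_solution_0 flip: matrix_mul_assoc)

text \<open>If \<open>a\<close> were annihilated by the upper block, then \<open>J\<close> would be nonpositive at \<open>x = 0\<close> on
  \<open>weyl_solution z a\<close>.\<close>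
lemma invertible_upper:
  assumes "z \<in> regular"
  shows "invertible (upper z)"
proof (rule invertible_if_injective, rule ccontr)
  fix a :: "complex ^ 'p ^ 'p" assume "upper z ** a = 0" and "a \<noteq> 0"
  then have "jform (weyl_solution z a 0) = - (norm (lower z ** a))\<^sup>2"
    by (simp add: jform_vstack flip: vstack_upper_lower)
  then show False
    using jform_weyl_solution(2)[OF assms order_refl \<open>a \<noteq> 0\<close>] by simp
qed

lemma weyl_solution_\<phi>\<^sub>0:
  "z \<in> regular \<Longrightarrow> weyl_solution z (matrix_inv (upper z)) 0 = vstack (mat 1) (\<phi>\<^sub>0 z)"
  by (simp add: \<phi>\<^sub>0_def matrix_inv_right invertible_upper flip: vstack_upper_lower)

text \<open>\<open>J \<ge> 0\<close> for the initial value \<open>[I; \<phi>\<^sub>0]\<close>.\<close>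
lemma norm_\<phi>\<^sub>0_le: "z \<in> regular \<Longrightarrow> norm (\<phi>\<^sub>0 z) \<le> norm (mat 1 :: complex ^ 'p ^ 'p)"
  using jform_weyl_solution(1)[of z 0 "matrix_inv (upper z)"]
  by (simp add: weyl_solution_\<phi>\<^sub>0 jform_vstack power2_le_iff_abs_le)

lemma jform_fundamental_\<phi>\<^sub>0:
  assumes "z \<in> regular" and W: "fundamental_solution (hamiltonian b') z W" and "0 \<le> x"
  shows "0 \<le> jform (W x ** vstack (mat 1) (\<phi>\<^sub>0 z))"
  using canonical_solution_unique[OF continuous_b' W weyl_solution_canonical[OF assms(1)] assms(3)]
    jform_weyl_solution(1)[OF assms(1,3)] weyl_solution_\<phi>\<^sub>0[OF assms(1)] by metis

lemma holomorphic_\<phi>\<^sub>0: "(\<lambda>z. \<phi>\<^sub>0 z $ i $ k) holomorphic_on regular"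
proof -
  have sub: "regular \<subseteq> \<complex>\<^sub>+" by (auto simp: regular_def)
  have "z\<^sub>1 holomorphic_on regular"
    by (rule holomorphic_on_subset[OF holomorphic_root[OF c_nonzero z\<^sub>1] sub])
  then have r: "(\<lambda>z. 1 / z * (z + of_real c - z\<^sub>1 z)) holomorphic_on regular"
    by (intro holomorphic_intros) (use sub upper_half_planeD in auto)
  have E: "(\<lambda>z. E z $ i $ k) holomorphic_on regular" for i k
  proof (cases i)
    case (Inr l)
    have "(\<lambda>z. 1 / z * (z + of_real c - z\<^sub>1 z) * mat 1 $ l $ k) holomorphic_on regular"
      by (rule holomorphic_on_mult[OF r]) simp
    then show ?thesis by (simp add: Inr E\<^sub>1_def vstack_def cscale_def)
  qed (simp add: E\<^sub>1_def vstack_def)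
  have shift: "(\<lambda>z. (A - mat z) $ i $ k) holomorphic_on regular" for i k
    by (cases "i = k") (auto simp: mat_def intro!: holomorphic_intros)
  have "(\<lambda>z. matrix_inv (A - mat z) $ i $ k) holomorphic_on regular" for i k
    by (rule holomorphic_on_matrix_inv[OF shift]) (simp add: regular_def)
  then have "(\<lambda>z. (jmat ** ctranspose (\<Lambda> 0) ** matrix_inv (S 0) ** matrix_inv (A - mat z) ** \<Lambda> 0) $ i $ k)
      holomorphic_on regular" for i k
    by (intro holomorphic_on_matrix_mult) (auto intro: holomorphic_on_const)
  then have "(\<lambda>z. w 0 z $ i $ k) holomorphic_on regular" for i k
    unfolding w\<^sub>A_def cscale_def by (auto intro!: holomorphic_intros)
  then have "(\<lambda>z. v 0 z $ i $ k) holomorphic_on regular" for i k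
    unfolding v\<^sub>A_def by (intro holomorphic_on_matrix_mult) (auto intro: holomorphic_on_const)
  then have ul: "(\<lambda>z. (upper z) $ i $ k) holomorphic_on regular" "(\<lambda>z. (lower z) $ i $ k) holomorphic_on regular" for i k
    by (intro holomorphic_on_matrix_mult E; simp)+
  show ?thesis
    unfolding \<phi>\<^sub>0_def
    by (intro holomorphic_on_matrix_mult ul holomorphic_on_matrix_inv) (rule invertible_upper)
qed

text \<open>Riemann's theorem on removable singularities, entry by entry.\<close>
lemma bounded_extension:
  "\<exists>\<phi> :: complex \<Rightarrow> complex ^ 'p ^ 'p. (\<forall>i k. (\<lambda>z. \<phi> z $ i $ k) holomorphic_on \<complex>\<^sub>+) \<and> (\<forall>z\<in>regular. \<phi> z = \<phi>\<^sub>0 z)"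
proof -
  let ?X = "\<complex>\<^sub>+ - regular"
  have reg: "\<complex>\<^sub>+ - ?X = regular" by (auto simp: regular_def)
  have "\<exists>g. g holomorphic_on \<complex>\<^sub>+ \<and> (\<forall>z\<in>\<complex>\<^sub>+ - ?X. g z = \<phi>\<^sub>0 z $ i $ k)" for i k
  proof (rule removable_singularities[OF finite_singular])
    show "?X \<subseteq> interior \<complex>\<^sub>+" by (simp add: interior_open open_upper_half_plane)
    show "(\<lambda>z. \<phi>\<^sub>0 z $ i $ k) holomorphic_on \<complex>\<^sub>+ - ?X" unfolding reg by (rule holomorphic_\<phi>\<^sub>0)
    fix z assume z: "z \<in> ?X"
    have "open (\<complex>\<^sub>+ - (?X - {z}))"
      by (intro open_Diff open_upper_half_plane finite_imp_closed) (simp add: finite_singular)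
    then have "\<forall>\<^sub>F t in at z. t \<in> \<complex>\<^sub>+ - (?X - {z}) - {z}"
      using z eventually_at_in_open[of "\<complex>\<^sub>+ - (?X - {z})" z] by simp
    then have "\<forall>\<^sub>F t in at z. norm (\<phi>\<^sub>0 t $ i $ k) \<le> norm (mat 1 :: complex ^ 'p ^ 'p) * norm (1 :: complex)"
    proof (rule eventually_mono)
      fix t assume "t \<in> \<complex>\<^sub>+ - (?X - {z}) - {z}"
      then have "t \<in> regular" by auto
      then show "norm (\<phi>\<^sub>0 t $ i $ k) \<le> norm (mat 1 :: complex ^ 'p ^ 'p) * norm (1 :: complex)"
        using norm_\<phi>\<^sub>0_le[of t] Finite_Cartesian_Product.norm_nth_le[of "\<phi>\<^sub>0 t" i] Finite_Cartesian_Product.norm_nth_le[of "\<phi>\<^sub>0 t $ i" k] by simp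
    qed
    then show "(\<lambda>z. \<phi>\<^sub>0 z $ i $ k) \<in> O[at z](\<lambda>_. 1)" by (rule bigoI)
  qed
  then obtain g where g: "\<And>i k. g i k holomorphic_on \<complex>\<^sub>+" "\<And>i k z. z \<in> regular \<Longrightarrow> g i k z = \<phi>\<^sub>0 z $ i $ k"
    unfolding reg by metis
  show ?thesis
    by (rule exI[of _ "\<lambda>z. \<chi> i k. g i k z"]) (use g in \<open>auto simp: vec_eq_iff\<close>)
qed

text \<open>At the finitely many exceptional points no explicit solution is at hand, but \<open>J \<ge> 0\<close> on the solution
  with initial value \<open>[I; \<phi>(z)]\<close> holds nearby and passes to the limit.\<close>
lemma extension_weyl:
  fixes \<phi> :: "complex \<Rightarrow> complex ^ 'p ^ 'p"
  assumes hol: "\<And>i k. (\<lambda>z. \<phi> z $ i $ k) holomorphic_on \<complex>\<^sub>+" and eq: "\<And>z. z \<in> regular \<Longrightarrow> \<phi> z = \<phi>\<^sub>0 z"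
  shows "weyl_function (hamiltonian b') \<phi>"
proof -
  obtain W where W: "\<And>z. fundamental_solution (hamiltonian b') z (W z)"
      and W_cont: "\<And>x. 0 \<le> x \<Longrightarrow> continuous_on UNIV (\<lambda>z. W z x)"
    by (rule fundamental_solution_exists[OF continuous_b']) blast
  have nonneg: "0 \<le> jform (W z x ** vstack (mat 1) (\<phi> z))" if z: "z \<in> \<complex>\<^sub>+" and x: "0 \<le> x" for z x
  proof -
    have "continuous_on \<complex>\<^sub>+ (\<lambda>z. vstack (mat 1) (\<phi> z) $ i $ k)" for i k
      by (cases i) (auto simp: vstack_def intro!: continuous_intros holomorphic_on_imp_continuous_on hol)
    then have "continuous_on \<complex>\<^sub>+ (\<lambda>z. vstack (mat 1) (\<phi> z))"
      by (rule continuous_on_matrixI)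
    moreover have "continuous_on \<complex>\<^sub>+ (\<lambda>z. W z x)"
      by (rule continuous_on_subset[OF W_cont[OF x]]) auto
    ultimately have "continuous_on \<complex>\<^sub>+ (\<lambda>z. jform (W z x ** vstack (mat 1) (\<phi> z)))"
      unfolding jform_def
      by (intro continuous_on_inner continuous_on_matrix_mult continuous_on_const)
    then have "isCont (\<lambda>z. jform (W z x ** vstack (mat 1) (\<phi> z))) z"
      by (rule continuous_on_interior) (simp add: z interior_open open_upper_half_plane)
    then have "((\<lambda>z. jform (W z x ** vstack (mat 1) (\<phi> z))) \<longlongrightarrow> jform (W z x ** vstack (mat 1) (\<phi> z))) (at z)"
      by (rule isContD)
    moreover have "\<forall>\<^sub>F t in at z. 0 \<le> jform (W t x ** vstack (mat 1) (\<phi> t))"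
    proof -
      have "open (\<complex>\<^sub>+ - ((\<complex>\<^sub>+ - regular) - {z}))"
        by (intro open_Diff open_upper_half_plane finite_imp_closed) (simp add: finite_singular)
      then have "\<forall>\<^sub>F t in at z. t \<in> \<complex>\<^sub>+ - ((\<complex>\<^sub>+ - regular) - {z}) - {z}"
        using z eventually_at_in_open[of "\<complex>\<^sub>+ - ((\<complex>\<^sub>+ - regular) - {z})" z] by simp
      then show ?thesis
      proof (rule eventually_mono)
        fix t assume "t \<in> \<complex>\<^sub>+ - ((\<complex>\<^sub>+ - regular) - {z}) - {z}"
        then have "t \<in> regular" by auto
        then show "0 \<le> jform (W t x ** vstack (mat 1) (\<phi> t))"
          using jform_fundamental_\<phi>\<^sub>0[OF _ W x] by (simp add: eq)
      qed
    qed
    ultimately show ?thesis by (rule tendsto_lowerbound) simp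
  qed
  show ?thesis
    unfolding weyl_function_def
  proof (intro conjI allI ballI hol)
    fix z assume z: "z \<in> \<complex>\<^sub>+"
    have "canonical_solution (hamiltonian b') z (\<lambda>x. W z x ** vstack (mat 1) (\<phi> z))"
      using W by (intro canonical_solution_mult) (simp add: fundamental_solution_iff)
    then have "(\<lambda>x. hstack (mat 1) (ctranspose (\<phi> z)) ** ctranspose (W z x) ** hamiltonian b' x ** W z x
             ** vstack (mat 1) (\<phi> z)) absolutely_integrable_on {0..}"
      unfolding weyl_integrand_integrable_iff[OF continuous_b' W]
      by (rule norm_integrable_if_jform_nonneg) (use z upper_half_planeD nonneg in auto)
    then show "\<exists>W. fundamental_solution (hamiltonian b') z W \<and>
        (\<lambda>x. hstack (mat 1) (ctranspose (\<phi> z)) ** ctranspose (W x) ** hamiltonian b' x ** W x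
             ** vstack (mat 1) (\<phi> z)) absolutely_integrable_on {0..}"
      using W by blast
  qed
qed

text \<open>The difference of two square integrable solutions has initial value \<open>[0; F - G]\<close>; it is \<open>v y\<close> with
  \<open>y\<close> a combination of a decaying and a growing exponential.  The growing one occurs, since otherwise
  \<open>J\<close> would be positive at \<open>[0; F - G]\<close>.  As its rate \<open>Im (z\<^sub>1 z)\<close> exceeds the rate \<open>K\<close> of \<open>\<Lambda>\<close>,
  \<open>square_integrable_growth\<close> forces the difference to grow.\<close>
lemma square_integrable_unique:
  assumes z: "z \<in> regular" "invertible (A - mat (cnj z))"
    and large: "norm A * norm (jmat :: complex ^ ('p + 'p) ^ ('p + 'p)) * (norm (beta c \<alpha> 0))\<^sup>2 < Im (z\<^sub>1 z)"
    and W: "fundamental_solution (hamiltonian b') z W"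
    and F: "(\<lambda>x. (norm (b' x ** (W x ** vstack (mat 1) F)))\<^sup>2) integrable_on {0..}"
    and G: "(\<lambda>x. (norm (b' x ** (W x ** vstack (mat 1) G)))\<^sup>2) integrable_on {0..}"
  shows "F = G"
proof (rule ccontr)
  assume "F \<noteq> G"
  let ?\<zeta> = "z\<^sub>1 z" and ?H = "hamiltonian b'" and ?B = "norm (beta c \<alpha> 0)"
  define K where "K = norm A * norm (jmat :: complex ^ ('p + 'p) ^ ('p + 'p)) * ?B\<^sup>2"
  define D where "D = F - G"
  have z': "z \<in> \<complex>\<^sub>+" "invertible (A - mat z)" "0 < Im z" "z \<noteq> 0"
    using z upper_half_planeD by (auto simp: regular_def)
  have \<zeta>: "?\<zeta>\<^sup>2 = of_real c * (2 * z + of_real c)" "0 < Im ?\<zeta>" using z\<^sub>1[OF z'(1)] by auto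
  have "invertible (matrix_inv (w 0 0))"
    by (rule invertible_left[OF matrix_inv_right[OF invertible_w_0]]) simp
  moreover have "invertible (w 0 z)"
    by (rule invertible_w) (use z z' in auto)
  ultimately have "invertible (v 0 z)"
    unfolding v\<^sub>A_def by (rule invertible_mult)
  have "\<exists>a d. matrix_inv (v 0 z) ** vstack 0 D = mode c \<alpha> z ?\<zeta> 0 ** a + mode c \<alpha> z (- ?\<zeta>) 0 ** (d :: complex ^ 'p ^ 'p)"
    by (rule modes_span[OF \<alpha>_unitary]) (use z' \<zeta> in auto)
  then obtain a d :: "complex ^ 'p ^ 'p" where
    ad: "matrix_inv (v 0 z) ** vstack 0 D = mode c \<alpha> z ?\<zeta> 0 ** a + mode c \<alpha> z (- ?\<zeta>) 0 ** d"
    by blast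
  then have ad': "v 0 z ** (mode c \<alpha> z ?\<zeta> 0 ** a + mode c \<alpha> z (- ?\<zeta>) 0 ** d) = vstack 0 D"
    using matrix_inv_right_cancel[OF \<open>invertible (v 0 z)\<close>] by metis
  have "d \<noteq> 0"
  proof
    assume "d = 0"
    then have "weyl_solution z a 0 = vstack 0 D"
      using ad' by (simp add: weyl_solution_def matrix_mult_linear)
    moreover have "vstack 0 D \<noteq> 0"
      using \<open>F \<noteq> G\<close> by (simp add: D_def block_eq_iff flip: vstack_zero)
    ultimately have "a \<noteq> 0" by (auto simp: weyl_solution_def matrix_mult_linear)
    from jform_weyl_solution(2)[OF z(1) order_refl this] \<open>weyl_solution z a 0 = vstack 0 D\<close>
    show False by (simp add: jform_vstack)
  qed
  define y where "y x = mode c \<alpha> z ?\<zeta> x ** a + mode c \<alpha> z (- ?\<zeta>) x ** d" for x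
  have y: "canonical_solution H z y"
  proof -
    have "canonical_solution H z (\<lambda>x. mode c \<alpha> z ?\<zeta> x ** a)" "canonical_solution H z (\<lambda>x. mode c \<alpha> z (- ?\<zeta>) x ** d)"
      by (auto intro!: canonical_solution_mult mode_solution[OF \<alpha>_unitary] simp: z' \<zeta>)
    then show ?thesis
      unfolding y_def canonical_solution_def
      by (auto simp: matrix_mult_linear cscale_linear intro!: has_vector_derivative_add)
  qed
  let ?f = "\<lambda>x. beta c \<alpha> x ** (w x z ** y x)"
  define YF where "YF x = W x ** vstack (mat 1) F" for x
  define YG where "YG x = W x ** vstack (mat 1) G" for x
  have YF: "canonical_solution ?H z YF" and YG: "canonical_solution ?H z YG"
    using W unfolding YF_def YG_def by (auto intro!: canonical_solution_mult simp: fundamental_solution_iff)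
  \<comment> \<open>A majorant of the integrand of the difference whose primitive is known from the energy identity.\<close>
  define \<psi> where "\<psi> x = 2 * ((norm (b' x ** YF x))\<^sup>2 + (norm (b' x ** YG x))\<^sup>2)" for x
  define \<Psi> where "\<Psi> x = (- 1 / Im z) *\<^sub>R (jform (YF x) + jform (YG x))" for x
  have \<Psi>: "(\<Psi> has_vector_derivative \<psi> x) (at x within {0..})" if "0 \<le> x" for x
    unfolding \<Psi>_def
    by (rule has_vector_derivative_eq_rhs[OF bounded_linear.has_vector_derivative[OF bounded_linear_scaleR_right
          has_vector_derivative_add[OF jform_derivative[OF YF that] jform_derivative[OF YG that]]]])
      (use z'(3) in \<open>simp add: \<psi>_def field_simps\<close>)
  have f_le: "(norm (?f x))\<^sup>2 \<le> \<psi> x" if x: "0 \<le> x" for x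
  proof -
    have "v x z ** y x = W x ** (v 0 z ** y 0)"
      using canonical_solution_unique[OF continuous_b' W darboux_solution[OF z'(2) y] x] .
    also have "v 0 z ** y 0 = vstack (mat 1) F - vstack (mat 1) G"
      unfolding y_def ad' by (simp add: vstack_diff D_def)
    finally have "v x z ** y x = YF x - YG x"
      by (simp add: YF_def YG_def matrix_mult_diff_right)
    then have "?f x = b' x ** YF x - b' x ** YG x"
      using b'_darboux_solution[OF x, of z "y x"] by (simp add: matrix_mult_diff_right)
    then have "norm (?f x) \<le> norm (b' x ** YF x) + norm (b' x ** YG x)"
      using norm_triangle_ineq4 by metis
    then have "(norm (?f x))\<^sup>2 \<le> (norm (b' x ** YF x) + norm (b' x ** YG x))\<^sup>2"
      by (rule power_mono) simp
    also have "\<dots> \<le> \<psi> x"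
      unfolding \<psi>_def using sum_squares_bound[of "norm (b' x ** YF x)" "norm (b' x ** YG x)"]
      by (simp add: power2_sum)
    finally show ?thesis .
  qed
  have int: "\<psi> integrable_on {0..}"
    unfolding \<psi>_def YF_def YG_def by (intro integrable_on_mult_right integrable_add F G)
  have nonneg: "0 \<le> \<psi> x" for x by (simp add: \<psi>_def)
  have bound: "\<Psi> x \<le> \<Psi> 0 + integral {0..} \<psi>" if "0 \<le> x" for x
    using primitive_bounded_if_integrable[OF \<Psi> nonneg int that] by simp
  have "norm (beta c \<alpha> x) \<le> ?B" for x by (simp add: norm_beta[of c \<alpha> x])
  from square_integrable_growth[OF this z'(2) y \<Psi> f_le bound]
  obtain C where C: "\<And>x. 0 \<le> x \<Longrightarrow> norm (beta c \<alpha> x ** y x) \<le> norm (?f x) + C * exp (K * x)"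
    unfolding K_def by blast
  define r where "r = cmod (ratio c z ?\<zeta> - 1) * norm a"
  define \<gamma> where "\<gamma> = cmod (ratio c z (- ?\<zeta>) - 1) * norm d"
  have "z * ratio c z (- ?\<zeta>) = z + of_real c + ?\<zeta>"
    using z'(4) by (simp add: ratio_def)
  then have "ratio c z (- ?\<zeta>) \<noteq> 1"
    using \<zeta>(2) by (auto simp: complex_eq_iff)
  then have "0 < \<gamma>" using \<open>d \<noteq> 0\<close> by (simp add: \<gamma>_def)
  have lower: "\<gamma> * exp (Im ?\<zeta> * x) - (C + r) * exp (K * x) \<le> norm (?f x)" if x: "0 \<le> x" for x
  proof -
    have "beta c \<alpha> x ** y x = ((ratio c z ?\<zeta> - 1) * exp (\<i> * ?\<zeta> * of_real x)) *c (\<alpha> ** a)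
        + ((ratio c z (- ?\<zeta>) - 1) * exp (\<i> * (- ?\<zeta>) * of_real x)) *c (\<alpha> ** d)"
      unfolding y_def matrix_mult_add_right matrix_mul_assoc beta_mode[OF \<alpha>_unitary] matrix_mult_cscale_left ..
    then have "norm (((ratio c z (- ?\<zeta>) - 1) * exp (\<i> * (- ?\<zeta>) * of_real x)) *c (\<alpha> ** d))
        \<le> norm (beta c \<alpha> x ** y x) + norm (((ratio c z ?\<zeta> - 1) * exp (\<i> * ?\<zeta> * of_real x)) *c (\<alpha> ** a))"
      by (metis add_diff_cancel_left' norm_triangle_ineq4)
    then have "\<gamma> * exp (Im ?\<zeta> * x) \<le> norm (beta c \<alpha> x ** y x) + r * exp (- (Im ?\<zeta> * x))"
      by (simp add: norm_cscale norm_mult norm_\<alpha>_mult[OF \<alpha>_unitary] r_def \<gamma>_def mult_ac)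
    moreover have "r * exp (- (Im ?\<zeta> * x)) \<le> r * exp (K * x)"
      using x \<zeta>(2) by (intro mult_left_mono) (auto simp: r_def K_def intro: order_trans[of _ 0])
    ultimately show ?thesis using C[OF x] by (simp add: algebra_simps)
  qed
  have "0 \<le> K" "K < Im ?\<zeta>" using large by (simp_all add: K_def)
  \<comment> \<open>Beyond \<open>X\<close> the bound \<open>exp t \<ge> t\<close> makes the growing exponential exceed the error term by
    \<open>exp (K x)\<close>.\<close>
  define X where "X = max 0 ((C + r + 1) / (\<gamma> * (Im ?\<zeta> - K)))"
  have ge1: "1 \<le> \<psi> x" if x: "X \<le> x" for x
  proof -
    have "0 \<le> x" "(C + r + 1) / (\<gamma> * (Im ?\<zeta> - K)) \<le> x" using x by (auto simp: X_def)
    then have "C + r + 1 \<le> \<gamma> * ((Im ?\<zeta> - K) * x)"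
      using \<open>0 < \<gamma>\<close> \<open>K < Im ?\<zeta>\<close> by (simp add: field_simps)
    also have "\<dots> \<le> \<gamma> * exp ((Im ?\<zeta> - K) * x)"
      using \<open>0 < \<gamma>\<close> by (intro mult_left_mono order_trans[OF _ exp_ge_add_one_self]) auto
    finally have "1 \<le> \<gamma> * exp ((Im ?\<zeta> - K) * x) - (C + r)" by simp
    then have "exp (K * x) * 1 \<le> exp (K * x) * (\<gamma> * exp ((Im ?\<zeta> - K) * x) - (C + r))"
      by (intro mult_left_mono) auto
    also have "\<dots> = \<gamma> * exp (Im ?\<zeta> * x) - (C + r) * exp (K * x)"
      by (simp add: algebra_simps exp_add[symmetric])
    also have "\<dots> \<le> norm (?f x)" by (rule lower[OF \<open>0 \<le> x\<close>])
    finally have "1 \<le> norm (?f x)"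
      using \<open>0 \<le> K\<close> \<open>0 \<le> x\<close> by (smt (verit) mult_nonneg_nonneg one_le_exp_iff mult.right_neutral)
    then have "1 \<le> (norm (?f x))\<^sup>2" by (simp add: one_le_power)
    also have "\<dots> \<le> \<psi> x" by (rule f_le[OF \<open>0 \<le> x\<close>])
    finally show ?thesis .
  qed
  define M where "M = \<Psi> 0 + integral {0..} \<psi> - \<Psi> X"
  have "0 \<le> X" by (simp add: X_def)
  have "0 \<le> M" using bound[OF \<open>0 \<le> X\<close>] by (simp add: M_def)
  \<comment> \<open>From \<open>X\<close> on, \<open>\<Psi>\<close> increases at least with slope \<open>1\<close>, so it overtakes its bound.\<close>
  have "norm ((X + (M + 1)) - X) \<le> \<Psi> (X + (M + 1)) - \<Psi> X"
    by (rule norm_diff_le_by_derivative[where f' = "\<lambda>_. 1" and f = "\<lambda>x. x" and \<phi>' = \<psi>])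
      (use \<Psi> ge1 \<open>0 \<le> X\<close> \<open>0 \<le> M\<close> in \<open>auto intro: derivative_intros\<close>)
  then show False
    using bound[of "X + (M + 1)"] \<open>0 \<le> X\<close> \<open>0 \<le> M\<close> by (simp add: M_def)
qed

text \<open>On a nonempty open set \<open>square_integrable_unique\<close> applies: \<open>(Im z\<^sub>1)\<^sup>2 \<ge> - Re (z\<^sub>1\<^sup>2) = - c (2 Re z + c)\<close>,
  which exceeds \<open>K\<^sup>2\<close> when \<open>Re z\<close> is large in absolute value and has the sign opposite to that of \<open>c\<close>.
  Analytic continuation does the rest.\<close>
lemma weyl_function_unique:
  assumes \<phi>: "weyl_function (hamiltonian b') \<phi>" and \<psi>: "weyl_function (hamiltonian b') \<psi>" and "z \<in> \<complex>\<^sub>+"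
  shows "\<psi> z = \<phi> z"
proof -
  define K where "K = norm A * norm (jmat :: complex ^ ('p + 'p) ^ ('p + 'p)) * (norm (beta c \<alpha> 0))\<^sup>2"
  \<comment> \<open>Removing the spectra of \<open>A\<close> and \<open>A\<^sup>*\<close> makes \<open>w\<close> both defined and invertible.\<close>
  define X where "X = {z. \<not> invertible (A - mat z)} \<union> cnj ` {z. \<not> invertible (A - mat z)}"
  define U where "U = \<complex>\<^sub>+ \<inter> {z. c * (2 * Re z + c) < - K\<^sup>2}"
  have "finite X" using finite_not_invertible_shift[OF invertible_A] by (simp add: X_def)
  have "open U"
    unfolding U_def by (intro open_Int open_upper_half_plane open_Collect_less continuous_intros)
  have "U \<noteq> {}"
  proof -
    \<comment> \<open>The real part at which \<open>c (2 t + c) = - K\<^sup>2 - 1\<close>.\<close>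
    define t where "t = ((- K\<^sup>2 - 1) / c - c) / 2"
    have "c * (2 * t + c) = - K\<^sup>2 - 1" using c_nonzero by (simp add: t_def field_simps)
    then have "Complex t 1 \<in> U" by (simp add: U_def upper_half_plane_def)
    then show ?thesis by blast
  qed
  then have "U - X \<noteq> {}"
    using \<open>finite X\<close> \<open>open U\<close> by (metis Diff_eq_empty_iff finite_imp_not_open finite_subset)
  have eq: "\<psi> t = \<phi> t" if t: "t \<in> U - X" for t
  proof -
    have "t \<in> \<complex>\<^sub>+" using t by (simp add: U_def)
    have "invertible (A - mat t)" "invertible (A - mat (cnj t))"
      using t unfolding X_def by (auto, metis (mono_tags, lifting) complex_cnj_cnj image_eqI mem_Collect_eq)
    have "(Im (z\<^sub>1 t))\<^sup>2 = (Re (z\<^sub>1 t))\<^sup>2 - Re ((z\<^sub>1 t)\<^sup>2)"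
      by (simp add: power2_eq_square)
    also have "Re ((z\<^sub>1 t)\<^sup>2) = c * (2 * Re t + c)"
      using z\<^sub>1[OF \<open>t \<in> \<complex>\<^sub>+\<close>] by simp
    finally have "(Im (z\<^sub>1 t))\<^sup>2 = (Re (z\<^sub>1 t))\<^sup>2 - c * (2 * Re t + c)" .
    moreover have "c * (2 * Re t + c) < - K\<^sup>2"
      using t by (simp add: U_def)
    ultimately have "K\<^sup>2 < (Im (z\<^sub>1 t))\<^sup>2"
      using zero_le_power2[of "Re (z\<^sub>1 t)"] by linarith
    then have "K < Im (z\<^sub>1 t)"
      using z\<^sub>1[OF \<open>t \<in> \<complex>\<^sub>+\<close>] by (meson less_imp_le power_less_imp_less_base)
    obtain W where W: "fundamental_solution (hamiltonian b') t W"
      by (rule fundamental_solution_exists[OF continuous_b']) blast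
    have int: "(\<lambda>x. (norm (b' x ** (W x ** vstack (mat 1) (\<theta> t))))\<^sup>2) integrable_on {0..}"
      if \<theta>: "weyl_function (hamiltonian b') \<theta>" for \<theta>
    proof -
      obtain V where V: "fundamental_solution (hamiltonian b') t V"
        and "(\<lambda>x. hstack (mat 1) (ctranspose (\<theta> t)) ** ctranspose (V x) ** hamiltonian b' x ** V x
             ** vstack (mat 1) (\<theta> t)) absolutely_integrable_on {0..}"
        using \<theta> \<open>t \<in> \<complex>\<^sub>+\<close> unfolding weyl_function_def by blast
      then have int: "(\<lambda>x. (norm (b' x ** (V x ** vstack (mat 1) (\<theta> t))))\<^sup>2) integrable_on {0..}"
        by (simp only: weyl_integrand_integrable_iff[OF continuous_b' V])
      have "V x = W x" if "0 \<le> x" for x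
        using canonical_solution_unique[OF continuous_b' W _ that, of V] V by (simp add: fundamental_solution_iff)
      then show ?thesis
        by (intro integrable_eq[OF int]) auto
    qed
    show ?thesis
      by (rule square_integrable_unique[OF _ _ _ W int[OF \<psi>] int[OF \<phi>]])
        (use \<open>t \<in> \<complex>\<^sub>+\<close> \<open>invertible (A - mat t)\<close> \<open>invertible (A - mat (cnj t))\<close> \<open>K < Im (z\<^sub>1 t)\<close>
          in \<open>simp_all add: regular_def K_def\<close>)
  qed
  have "\<psi> z $ i $ k = \<phi> z $ i $ k" for i k
  proof (rule analytic_continuation_open[where s = "U - X" and s' = "\<complex>\<^sub>+"
        and f = "\<lambda>z. \<psi> z $ i $ k" and g = "\<lambda>z. \<phi> z $ i $ k"])
    show "open (U - X)" using \<open>open U\<close> \<open>finite X\<close> by (simp add: open_Diff finite_imp_closed)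
    show "connected \<complex>\<^sub>+"
      unfolding upper_half_plane_def by (intro convex_connected convex_halfspace_Im_gt)
    show "(\<lambda>z. \<psi> z $ i $ k) holomorphic_on \<complex>\<^sub>+" "(\<lambda>z. \<phi> z $ i $ k) holomorphic_on \<complex>\<^sub>+"
      using \<phi> \<psi> by (simp_all add: weyl_function_def)
  qed (use open_upper_half_plane \<open>U - X \<noteq> {}\<close> eq \<open>z \<in> \<complex>\<^sub>+\<close> in \<open>auto simp: U_def\<close>)
  then show ?thesis by (simp add: vec_eq_iff)
qed

text \<open>The exceptional set is the part of the spectrum of \<open>A\<close> in the upper half-plane.\<close>
theorem explicit_weyl_function:
  "\<exists>\<phi>. weyl_function (hamiltonian b') \<phi> \<and>
    (\<forall>\<psi>. weyl_function (hamiltonian b') \<psi> \<longrightarrow> (\<forall>z\<in>\<complex>\<^sub>+. \<psi> z = \<phi> z)) \<and>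
    (\<exists>P. P sparse_in \<complex>\<^sub>+ \<and>
      (\<forall>z\<in>\<complex>\<^sub>+ - P. invertible (A - mat z) \<and> invertible (upper z)) \<and>
      (\<forall>z\<in>\<complex>\<^sub>+. invertible (A - mat z) \<and> invertible (upper z) \<longrightarrow>
        \<phi> z = lower z ** matrix_inv (upper z)))"
proof -
  obtain \<phi> :: "complex \<Rightarrow> complex ^ 'p ^ 'p" where \<phi>: "\<And>i k. (\<lambda>z. \<phi> z $ i $ k) holomorphic_on \<complex>\<^sub>+" "\<And>z. z \<in> regular \<Longrightarrow> \<phi> z = \<phi>\<^sub>0 z"
    using bounded_extension by blast
  have weyl: "weyl_function (hamiltonian b') \<phi>"
    using \<phi> by (rule extension_weyl)
  show ?thesis
  proof (intro exI[of _ \<phi>] conjI exI[of _ "\<complex>\<^sub>+ - regular"] allI impI ballI weyl)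
    show "\<psi> z = \<phi> z" if "weyl_function (hamiltonian b') \<psi>" "z \<in> \<complex>\<^sub>+" for \<psi> z
      using weyl_function_unique[OF weyl that] .
    show "\<complex>\<^sub>+ - regular sparse_in \<complex>\<^sub>+"
      by (rule finite_imp_sparse[OF finite_singular])
    show "invertible (A - mat z)" "invertible (upper z)" if "z \<in> \<complex>\<^sub>+ - (\<complex>\<^sub>+ - regular)" for z
      using that invertible_upper by (auto simp: regular_def)
    show "\<phi> z = lower z ** matrix_inv (upper z)" if "z \<in> \<complex>\<^sub>+" "invertible (A - mat z) \<and> invertible (upper z)" for z
      using that \<phi>(2)[of z] by (simp add: regular_def \<phi>\<^sub>0_def)
  qed
qed

end

theorem theorem5p2:
  fixes c :: real
    and \<alpha> :: "complex ^ 'p ^ 'p"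
    and A :: "complex ^ 'n ^ 'n"
    and \<Lambda> :: "real \<Rightarrow> complex ^ ('p + 'p) ^ 'n"
    and S :: "real \<Rightarrow> complex ^ 'n ^ 'n"
    and z\<^sub>1 :: "complex \<Rightarrow> complex"
    and H H' :: "real \<Rightarrow> complex ^ ('p + 'p) ^ ('p + 'p)"
    and \<beta>' :: "real \<Rightarrow> complex ^ ('p + 'p) ^ 'p"
  assumes "c \<noteq> 0"
    and "\<alpha> ** ctranspose \<alpha> = mat 1"
    and H_def: "H = hamiltonian (beta c \<alpha>)"
    and "invertible A"
    and "pos_def (S 0)"
    and "A ** S 0 - S 0 ** ctranspose A = \<i> *c (\<Lambda> 0 ** jmat ** ctranspose (\<Lambda> 0))"
    and "\<And>x. 0 \<le> x \<Longrightarrow>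
      (\<Lambda> has_vector_derivative (- \<i>) *c (A ** \<Lambda> x ** jmat ** H x)) (at x within {0..})"
    and "\<And>x. 0 \<le> x \<Longrightarrow>
      (S has_vector_derivative \<Lambda> x ** jmat ** H x ** jmat ** ctranspose (\<Lambda> x)) (at x within {0..})"
    and \<beta>'_def: "\<beta>' = (\<lambda>x. beta c \<alpha> x ** w\<^sub>A A \<Lambda> S x 0)"
    and H'_def: "H' = hamiltonian \<beta>'"
    and "\<And>z. z \<in> \<complex>\<^sub>+ \<Longrightarrow>
      z\<^sub>1 z ^ 2 = of_real c * (2 * z + of_real c) \<and> 0 < Im (z\<^sub>1 z)"
  shows "\<exists>\<phi>. weyl_function H' \<phi> \<and>
    (\<forall>\<psi>. weyl_function H' \<psi> \<longrightarrow> (\<forall>z\<in>\<complex>\<^sub>+. \<psi> z = \<phi> z)) \<and>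
    (\<exists>P. P sparse_in \<complex>\<^sub>+ \<and>
      (\<forall>z\<in>\<complex>\<^sub>+ - P.
        invertible (A - mat z) \<and>
        invertible (hstack (mat 1) 0 ** v\<^sub>A A \<Lambda> S 0 z ** E\<^sub>1 c \<alpha> z\<^sub>1 z)) \<and>
      (\<forall>z\<in>\<complex>\<^sub>+.
        invertible (A - mat z) \<and>
        invertible (hstack (mat 1) 0 ** v\<^sub>A A \<Lambda> S 0 z ** E\<^sub>1 c \<alpha> z\<^sub>1 z) \<longrightarrow>
        \<phi> z = hstack 0 (mat 1) ** v\<^sub>A A \<Lambda> S 0 z ** E\<^sub>1 c \<alpha> z\<^sub>1 z **
              matrix_inv (hstack (mat 1) 0 ** v\<^sub>A A \<Lambda> S 0 z ** E\<^sub>1 c \<alpha> z\<^sub>1 z)))"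
proof -
  interpret explicit_system A c \<alpha> \<Lambda> S z\<^sub>1
    by unfold_locales (rule assms[unfolded H_def] continuous_beta | assumption)+
  have "H' = hamiltonian b'"
    by (simp add: H'_def \<beta>'_def b'_def[abs_def])
  then show ?thesis
    using explicit_weyl_function by (simp only:)
qed

end
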